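(* Let $(M,\mathcal T)$ be a closed triangulated surface with inversive distance $I\ge 0$ in hyperbolic background geometry. For every initial value $r(0)\in\Omega$, the solution $\{r(t)\mid 0\le t<T\}\subset\Omega$ to the flow $$r_i'(t)=-K_i(r(t))\sinh r_i(t),\qquad i=1,\dots,N,$$ exists and is unique on a maximal time interval $t\in[0,T)$ with $0<T\le+\infty$. Furthermore, whenever $T<+\infty$, the solution $r(t)$, $t\in[0,T)$, can be extended to a solution $\{r(t)\mid t\in[0,+\infty)\}\subset\mathbb R^N_{>0}$ of the extended flow $$r_i'(t)=-\widetilde K_i(r(t))\sinh r_i(t),\qquad i=1,\dots,N.$$
   Context: Setting. $M$ is a closed surface with a triangulation $\mathcal T=\{V,E,F\}$ (vertices, edges, faces), with vertices numbered $1,\dots,N$. The inversive distance is a fixed function $I:E\to[0,+\infty)$, $\{ij\}\mapsto I_{ij}$. For $r=(r_1,\dots,r_N)\in\mathbb R^N_{>0}$, each edge $\{ij\}$ gets the hyperbolic length $l_{ij}=\cosh^{-1}(\cosh r_i\cosh r_j+I_{ij}\sinh r_i\sinh r_j)$. $\Omega$ is the set of $r\in\mathbb R^N_{>0}$ such that for every face $\{ijk\}\in F$ the lengths $l_{ij},l_{jk},l_{ik}$ satisfy the three strict triangle inequalities. For $r\in\Omega$, $\theta_i^{jk}$ is the inner angle at vertex $i$ of the hyperbolic triangle with edge lengths $l_{ij},l_{jk},l_{ik}$, and the discrete Gaussian curvature is $K_i(r)=2\pi-\sum_{\{ijk\}\in F}\theta_i^{jk}$ (sum over faces containing $i$). Extended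 curvature. For every $r\in\mathbb R^N_{>0}$ and face $\{ijk\}$, the generalized inner angles are: $\tilde\theta_i^{jk}=\theta_i^{jk}$ (and similarly at $j,k$) if $l_{ij},l_{jk},l_{ik}$ satisfy the strict triangle inequalities; if one edge length is at least the sum of the other two, the generalized angle opposite to that edge is $\pi$ and the other two generalized angles are $0$. This gives continuous functions on $\mathbb R^3_{>0}$. The extended curvature is $\widetilde K_i(r)=2\pi-\sum_{\{ijk\}\in F}\tilde\theta_i^{jk}$, a continuous function on $\mathbb R^N_{>0}$ that agrees with $K_i$ on $\Omega$. *)

theory Defs
  imports "HOL-Analysis.Analysis"
begin

section \<open>Closed triangulated surfaces\<close>

text \<open>Connectedness is not required.  Second countability is automatic for compact,
  locally Euclidean spaces.\<close>

definition closed_surface :: "'a topology \<Rightarrow> bool" where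
  "closed_surface M \<longleftrightarrow>
     compact_space M \<and> Hausdorff_space M \<and>
     (\<forall>x \<in> topspace M. \<exists>U. openin M U \<and> x \<in> U \<and>
        (\<exists>W :: (real^2) set. open W \<and> subtopology M U homeomorphic_space top_of_set W))"

text \<open>The vertex set is the whole (finite) type \<open>'n\<close>, so that \<open>N = CARD('n)\<close> and
  functions on the vertices are vectors in \<open>real^'n\<close>.  The geometric realization is
  taken in barycentric coordinates.\<close>

definition realization :: "'n::finite set set \<Rightarrow> 'n set set \<Rightarrow> (real^'n) set" where
  "realization E F =
     {x. (\<forall>i. 0 \<le> x $ i) \<and> (\<Sum>i\<in>UNIV. x $ i) = 1 \<and>
         {i. x $ i \<noteq> 0} \<in> range (\<lambda>i. {i}) \<union> E \<union> F}"

definition triangulates :: "'n::finite set set \<Rightarrow> 'n set set \<Rightarrow> 'a topology \<Rightarrow> bool" where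
  "triangulates E F M \<longleftrightarrow>
     (\<forall>e\<in>E. card e = 2) \<and> (\<forall>f\<in>F. card f = 3) \<and>
     (\<forall>f\<in>F. \<forall>e. e \<subseteq> f \<and> card e = 2 \<longrightarrow> e \<in> E) \<and>
     top_of_set (realization E F) homeomorphic_space M"


section \<open>Inner angles of hyperbolic triangles\<close>

text \<open>The hyperboloid model of the hyperbolic plane.\<close>

definition mink :: "real^3 \<Rightarrow> real^3 \<Rightarrow> real" where
  "mink x y = x $ 1 * y $ 1 + x $ 2 * y $ 2 - x $ 3 * y $ 3"

definition hyp_plane :: "(real^3) set" where
  "hyp_plane = {x. mink x x = -1 \<and> 0 < x $ 3}"

definition hyp_dist :: "real^3 \<Rightarrow> real^3 \<Rightarrow> real" where
  "hyp_dist p q = arcosh (- mink p q)"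

text \<open>For \<open>p \<noteq> q\<close>, a positive multiple of the unit tangent vector at \<open>p\<close> of the geodesic
  from \<open>p\<close> to \<open>q\<close>: the orthogonal projection of \<open>q\<close> to the tangent plane at \<open>p\<close>.\<close>

definition hyp_dir :: "real^3 \<Rightarrow> real^3 \<Rightarrow> real^3" where
  "hyp_dir p q = q + mink p q *\<^sub>R p"

definition angle_at :: "real^3 \<Rightarrow> real^3 \<Rightarrow> real^3 \<Rightarrow> real" where
  "angle_at p q s =
     (let u = hyp_dir p q; v = hyp_dir p s
      in arccos (mink u v / (sqrt (mink u u) * sqrt (mink v v))))"

definition triangle_ineqs :: "real \<Rightarrow> real \<Rightarrow> real \<Rightarrow> bool" where
  "triangle_ineqs a b c \<longleftrightarrow> a < b + c \<and> b < a + c \<and> c < a + b"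

text \<open>The angle opposite to the side of length \<open>a\<close> in the hyperbolic triangle with side
  lengths \<open>a\<close>, \<open>b\<close>, \<open>c\<close>; well-definedness is part of the law of cosines below.\<close>

definition inner_angle :: "real \<Rightarrow> real \<Rightarrow> real \<Rightarrow> real" where
  "inner_angle a b c =
     (THE \<alpha>. \<exists>p\<in>hyp_plane. \<exists>q\<in>hyp_plane. \<exists>s\<in>hyp_plane.
        hyp_dist q s = a \<and> hyp_dist p q = b \<and> hyp_dist p s = c \<and> \<alpha> = angle_at p q s)"

definition gen_angle :: "real \<Rightarrow> real \<Rightarrow> real \<Rightarrow> real" where
  "gen_angle a b c =
     (if triangle_ineqs a b c then inner_angle a b c
      else if b + c \<le> a then pi else 0)"

lemma mink_le_minus_one:
  assumes "p \<in> hyp_plane" "q \<in> hyp_plane"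
  shows "1 \<le> - mink p q"
proof -
  have p: "(p$3)^2 = 1 + (p$1)^2 + (p$2)^2" "0 < p$3"
    and q: "(q$3)^2 = 1 + (q$1)^2 + (q$2)^2" "0 < q$3"
    using assms by (auto simp: hyp_plane_def mink_def power2_eq_square)
  have "(p$3 * q$3)^2 = (1 + p$1 * q$1 + p$2 * q$2)^2 + (p$1 - q$1)^2 + (p$2 - q$2)^2
      + (p$1 * q$2 - p$2 * q$1)^2"
    unfolding power_mult_distrib p q by (simp add: power2_eq_square algebra_simps)
  hence "(1 + p$1 * q$1 + p$2 * q$2)^2 \<le> (p$3 * q$3)^2"
    by simp
  hence "1 + p$1 * q$1 + p$2 * q$2 \<le> p$3 * q$3"
    by (rule power2_le_imp_le) (use p q in simp)
  thus ?thesis by (simp add: mink_def)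
qed

lemma angle_at_law_of_cosines:
  assumes "p \<in> hyp_plane" "q \<in> hyp_plane" "s \<in> hyp_plane"
    and "hyp_dist q s = a" "hyp_dist p q = b" "hyp_dist p s = c"
  shows "angle_at p q s = arccos ((cosh b * cosh c - cosh a) / (sinh b * sinh c))"
proof -
  have dist: "mink x y = - cosh (hyp_dist x y)" "0 \<le> hyp_dist x y"
    if "x \<in> hyp_plane" "y \<in> hyp_plane" for x y
    using mink_le_minus_one[OF that] by (simp_all add: hyp_dist_def cosh_arcosh_real)
  have self: "mink x x = -1" if "x \<in> hyp_plane" for x
    using that by (simp add: hyp_plane_def)
  have dir: "mink (hyp_dir p x) (hyp_dir p y)
      = mink x y + 2 * (mink p x * mink p y) + mink p x * mink p y * mink p p" for x y
    by (simp add: hyp_dir_def mink_def algebra_simps)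
  have norm: "sqrt (mink (hyp_dir p x) (hyp_dir p x)) = sinh (hyp_dist p x)"
    if "x \<in> hyp_plane" for x
  proof -
    have "mink (hyp_dir p x) (hyp_dir p x) = (sinh (hyp_dist p x))^2"
      using dist(1)[OF assms(1) that] self[OF assms(1)] self[OF that]
      by (simp add: dir sinh_square_eq) (simp add: power2_eq_square)
    thus ?thesis using dist(2)[OF assms(1) that] by simp
  qed
  have "mink (hyp_dir p q) (hyp_dir p s) = cosh b * cosh c - cosh a"
    using dist(1)[OF assms(2,3)] dist(1)[OF assms(1,2)] dist(1)[OF assms(1,3)]
      self[OF assms(1)] assms(4-6) by (simp add: dir)
  thus ?thesis
    using norm[OF assms(2)] norm[OF assms(3)] assms(5,6)
    by (simp add: angle_at_def Let_def)
qed

lemma inner_angle_law_of_cosines: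
  assumes "triangle_ineqs a b c"
  shows "inner_angle a b c = arccos ((cosh b * cosh c - cosh a) / (sinh b * sinh c))"
proof -
  define C where "C = (cosh b * cosh c - cosh a) / (sinh b * sinh c)"
  have pos: "0 < a" "0 < b" "0 < c"
    using assms by (auto simp: triangle_ineqs_def)
  have sh: "0 < sinh b * sinh c"
    using pos by simp
  have "cosh a \<le> cosh (b + c)"
    using assms pos by (subst cosh_real_nonneg_le_iff) (auto simp: triangle_ineqs_def)
  moreover have "cosh \<bar>b - c\<bar> \<le> cosh a"
    using assms pos by (subst cosh_real_nonneg_le_iff) (auto simp: triangle_ineqs_def)
  ultimately have C: "-1 \<le> C" "C \<le> 1"
    using sh by (auto simp: C_def le_divide_eq divide_le_eq cosh_add cosh_diff)
  define p q s :: "real^3" where "p = vector [0, 0, 1]"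
    and "q = vector [sinh b, 0, cosh b]"
    and "s = vector [sinh c * C, sinh c * sqrt (1 - C^2), cosh c]"
  note defs = p_def q_def s_def
  have C2: "(sqrt (1 - C^2))^2 = 1 - C^2"
    using C by (simp add: abs_square_le_1)
  have "mink s s = (sinh c)^2 * (C^2 + (sqrt (1 - C^2))^2) - (cosh c)^2"
    by (simp add: defs mink_def power2_eq_square algebra_simps del: real_sqrt_mult_self)
  hence "mink s s = -1"
    unfolding C2 by (simp add: sinh_square_eq)
  hence mem: "p \<in> hyp_plane" "q \<in> hyp_plane" "s \<in> hyp_plane"
    using sinh_square_eq[of b]
    by (auto simp: hyp_plane_def defs mink_def power2_eq_square)
  have "- mink q s = cosh b * cosh c - sinh b * sinh c * C"
    by (simp add: defs mink_def)
  hence "- mink q s = cosh a"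
    using pos by (simp add: C_def)
  moreover have "- mink p q = cosh b" "- mink p s = cosh c"
    by (simp_all add: defs mink_def)
  ultimately have dist: "hyp_dist q s = a" "hyp_dist p q = b" "hyp_dist p s = c"
    unfolding hyp_dist_def using pos by (simp_all add: arcosh_cosh_real)
  show ?thesis
    unfolding inner_angle_def
    by (rule the_equality)
       (use mem dist angle_at_law_of_cosines in metis, use angle_at_law_of_cosines in blast)
qed


section \<open>Inversive distance and curvatures\<close>

definition edge_length :: "('n::finite set \<Rightarrow> real) \<Rightarrow> real^'n \<Rightarrow> 'n \<Rightarrow> 'n \<Rightarrow> real" where
  "edge_length I r i j =
     arcosh (cosh (r $ i) * cosh (r $ j) + I {i, j} * sinh (r $ i) * sinh (r $ j))"

definition positive_orthant :: "(real^'n::finite) set" where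
  "positive_orthant = {r. \<forall>i. 0 < r $ i}"

definition admissible :: "'n::finite set set \<Rightarrow> ('n set \<Rightarrow> real) \<Rightarrow> (real^'n) set" where
  "admissible F I =
     {r \<in> positive_orthant. \<forall>i j k. {i, j, k} \<in> F \<longrightarrow>
        triangle_ineqs (edge_length I r i j) (edge_length I r j k) (edge_length I r i k)}"

text \<open>The angle at the vertex \<open>i\<close> of the face \<open>f = {i, j, k}\<close>.  The function \<open>A\<close>
  (\<^const>\<open>inner_angle\<close> or \<^const>\<open>gen_angle\<close>) gives the angle opposite to its first
  argument and is symmetric in the other two, so exchanging \<open>j\<close> and \<open>k\<close> has no effect.\<close>

definition face_angle ::
  "(real \<Rightarrow> real \<Rightarrow> real \<Rightarrow> real) \<Rightarrow> ('n::finite set \<Rightarrow> real) \<Rightarrow> real^'n \<Rightarrow> 'n \<Rightarrow> 'n set \<Rightarrow> real"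
where
  "face_angle A I r i f =
     (THE \<alpha>. \<exists>j k. f = {i, j, k} \<and> card f = 3 \<and>
        \<alpha> = A (edge_length I r j k) (edge_length I r i j) (edge_length I r i k))"

definition curvature :: "'n::finite set set \<Rightarrow> ('n set \<Rightarrow> real) \<Rightarrow> real^'n \<Rightarrow> 'n \<Rightarrow> real" where
  "curvature F I r i = 2 * pi - (\<Sum>f\<in>{f\<in>F. i \<in> f}. face_angle inner_angle I r i f)"

definition ext_curvature :: "'n::finite set set \<Rightarrow> ('n set \<Rightarrow> real) \<Rightarrow> real^'n \<Rightarrow> 'n \<Rightarrow> real" where
  "ext_curvature F I r i = 2 * pi - (\<Sum>f\<in>{f\<in>F. i \<in> f}. face_angle gen_angle I r i f)"

lemma edge_length_commute: "edge_length I r i j = edge_length I r j i"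
  by (simp add: edge_length_def insert_commute mult.commute mult.left_commute)

lemma inner_angle_commute: "inner_angle a b c = inner_angle a c b"
proof -
  have sym: "mink x y = mink y x" for x y
    by (simp add: mink_def mult.commute)
  have "hyp_dist x y = hyp_dist y x" for x y
    by (simp add: hyp_dist_def sym[of x y])
  moreover have "angle_at p q s = angle_at p s q" for p q s
    by (simp add: angle_at_def Let_def sym[of "hyp_dir p q" "hyp_dir p s"] mult.commute)
  ultimately show ?thesis
    unfolding inner_angle_def by (intro arg_cong[where f = The] ext) metis
qed

lemma gen_angle_commute: "gen_angle a b c = gen_angle a c b"
  by (auto simp: gen_angle_def triangle_ineqs_def inner_angle_commute[of a b c] add.commute)

lemma face_angle_eq:
  assumes "card {i, j, k} = 3" and sym: "\<And>a b c. A a b c = A a c b"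
  shows "face_angle A I r i {i, j, k}
    = A (edge_length I r j k) (edge_length I r i j) (edge_length I r i k)"
  unfolding face_angle_def
proof (rule the_equality)
  fix \<alpha>
  assume "\<exists>j' k'. {i, j, k} = {i, j', k'} \<and> card {i, j, k} = 3 \<and>
    \<alpha> = A (edge_length I r j' k') (edge_length I r i j') (edge_length I r i k')"
  then obtain j' k' where *: "{i, j, k} = {i, j', k'}"
    "\<alpha> = A (edge_length I r j' k') (edge_length I r i j') (edge_length I r i k')"
    by blast
  have "card {i, j', k'} = 3" using * assms(1) by simp
  hence "i \<noteq> j'" "i \<noteq> k'" "j' \<noteq> k'" "i \<noteq> j" "i \<noteq> k" "j \<noteq> k"
    using assms(1) by (auto simp: card_insert_if split: if_splits)
  hence "j' = j \<and> k' = k \<or> j' = k \<and> k' = j" using *(1) by (auto simp: set_eq_iff)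
  thus "\<alpha> = A (edge_length I r j k) (edge_length I r i j) (edge_length I r i k)"
    using *(2) sym edge_length_commute[of I r j k] by metis
qed (use assms in blast)


section \<open>Curvature flows\<close>

definition time_interval :: "ereal \<Rightarrow> real set" where
  "time_interval T = {t. 0 \<le> t \<and> ereal t < T}"

text \<open>\<open>r\<close> solves \<open>r\<^sub>i' = - K\<^sub>i(r) sinh r\<^sub>i\<close> on \<open>[0, T)\<close>, within \<open>D\<close>, with initial value
  \<open>r0\<close>; the derivative at \<open>0\<close> is one-sided.\<close>

definition flow_solution ::
  "(real^'n \<Rightarrow> 'n::finite \<Rightarrow> real) \<Rightarrow> (real^'n) set \<Rightarrow> real^'n \<Rightarrow> ereal \<Rightarrow> (real \<Rightarrow> real^'n) \<Rightarrow> bool"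
where
  "flow_solution K D r0 T r \<longleftrightarrow>
     r 0 = r0 \<and>
     (\<forall>t \<in> time_interval T. r t \<in> D \<and>
        (\<forall>i. ((\<lambda>t. r t $ i) has_real_derivative - K (r t) i * sinh (r t $ i))
               (at t within time_interval T)))"

end

theory Submission
  imports Defs "HOL-Complex_Analysis.Great_Picard"
begin

text \<open>
  The idea is to solve the extended flow first and to obtain the flow on the admissible set
  \<open>\<Omega>\<close> as its restriction.

  The extended flow has a solution \<open>R\<close> on \<open>[0, \<infinity>)\<close> from every initial point.  Generalized
  angles are continuous but not Lipschitz, because \<open>arccos\<close> has infinite slope at \<open>\<plusminus>1\<close>; so
  existence comes from Peano's theorem, here for bounded continuous fields on a Euclidean space
  (\<open>peano_global\<close>).  In the coordinates \<open>u\<^sub>i = - ln (tanh (r\<^sub>i / 2))\<close> the extended flow reads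
  \<open>u\<^sub>i' = K\<^sub>i\<close> with the extended curvature \<open>K\<^sub>i\<close>, a bounded function.  Hence \<open>u\<^sub>i\<close> stays finite
  in finite time, and \<open>r\<^sub>i\<close> stays positive.  To keep \<open>r\<^sub>i\<close> bounded one needs \<open>K\<^sub>i > 0\<close> when
  \<open>r\<^sub>i\<close> is large: if \<open>I \<ge> 0\<close>, the angles at \<open>i\<close> tend to \<open>0\<close> as \<open>r\<^sub>i\<close> tends to infinity,
  uniformly in the other radii (\<open>face_angle_small\<close>, \<open>eventually_ext_curvature_pos\<close>).
  \<open>bounded_field_flow_exists\<close> combines the two bounds.

  Let \<open>T\<close> be the first time at which \<open>R\<close> leaves \<open>\<Omega>\<close>.  As \<open>\<Omega>\<close> is open, \<open>T > 0\<close>; as the two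
  curvatures agree on \<open>\<Omega>\<close>, \<open>R\<close> restricted to \<open>[0, T)\<close> solves the original flow.  On \<open>\<Omega>\<close> the
  curvature is locally Lipschitz (\<open>lipschitz_near_ext_curvature\<close>), so any solution inside \<open>\<Omega>\<close>
  on \<open>[0, T')\<close> coincides with \<open>R\<close> there (\<open>solution_unique\<close>); since it stays in \<open>\<Omega>\<close>, so does
  \<open>R\<close>, and \<open>T' \<le> T\<close>.  This is uniqueness and maximality at once, and the required extension
  beyond \<open>T\<close> is \<open>R\<close> itself.
\<close>

section \<open>Global solutions for bounded continuous fields\<close>

lemma lipschitz_on_indefinite_integral:
  fixes g :: "real \<Rightarrow> 'a::euclidean_space"
  assumes cont: "continuous_on UNIV g" and bound: "\<And>s. norm (g s) \<le> C"
  shows "C-lipschitz_on UNIV (\<lambda>t. integral {0..t} g)"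
proof (rule lipschitz_on_leI)
  show "0 \<le> C" using bound[of 0] norm_ge_zero order_trans by blast
next
  fix s t :: real assume "s \<le> t"
  have int: "g integrable_on {a..b}" for a b
    by (rule integrable_continuous_real) (rule continuous_on_subset[OF cont], simp)
  have le: "norm (integral {a..b} g) \<le> C * (b - a)" if "a \<le> b" for a b
    by (rule integral_bound) (use that bound continuous_on_subset[OF cont] in auto)
  have C: "0 \<le> C" using bound[of 0] norm_ge_zero order_trans by blast
  have "norm (integral {0..t} g - integral {0..s} g) \<le> C * (t - s)"
  proof -
    consider "t < 0" | "s < 0" "0 \<le> t" | "0 \<le> s" by linarith
    thus ?thesis
    proof cases
      case 1
      thus ?thesis using \<open>s \<le> t\<close> C by simp
    next
      case 2
      have "norm (integral {0..t} g) \<le> C * t" using le[of 0 t] 2 by simp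
      also have "\<dots> \<le> C * (t - s)" using 2 C by (intro mult_left_mono) auto
      finally show ?thesis using 2 by simp
    next
      case 3
      have "integral {0..s} g + integral {s..t} g = integral {0..t} g"
        by (rule Henstock_Kurzweil_Integration.integral_combine) (use 3 \<open>s \<le> t\<close> int in auto)
      thus ?thesis using le[OF \<open>s \<le> t\<close>] by (metis add_diff_cancel_left')
    qed
  qed
  thus "dist (integral {0..s} g) (integral {0..t} g) \<le> C * dist s t"
    using \<open>s \<le> t\<close> by (simp add: dist_norm norm_minus_commute)
qed

text \<open>Tonelli's approximation of \<open>y' = f(y)\<close>: since the right-hand side only looks at \<open>y\<close> a
  time \<open>h\<close> earlier, each step of length \<open>h\<close> is a plain integration.  The function produced
  for \<open>k\<close> steps is one more Picard iterate; the iterate agrees with its predecessor up to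
  time \<open>k h\<close>, so delayed by \<open>h\<close> they agree up to time \<open>(k + 1) h\<close>.\<close>

lemma delayed_solution:
  fixes f :: "'a::euclidean_space \<Rightarrow> 'a"
  assumes cont: "continuous_on UNIV f" and bound: "\<And>x. norm (f x) \<le> C" and "0 < h"
  shows "\<exists>y. C-lipschitz_on UNIV y \<and> y 0 = x0 \<and>
    (\<forall>t \<le> real k * h. y t = x0 + integral {0..t} (\<lambda>s. f (y (s - h))))"
proof (induction k)
  case 0
  have "0 \<le> C" using bound[of 0] norm_ge_zero order_trans by blast
  moreover have "integral {0..t} (\<lambda>s. f x0) = 0" if "t \<le> 0" for t :: real
    using that by (cases "t = 0") auto
  ultimately show ?case by (intro exI[of _ "\<lambda>_. x0"]) (auto simp: lipschitz_on_def)
next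
  case (Suc k)
  then obtain y where y: "C-lipschitz_on UNIV y" "y 0 = x0"
    and eq: "\<And>t. t \<le> real k * h \<Longrightarrow> y t = x0 + integral {0..t} (\<lambda>s. f (y (s - h)))"
    by blast
  define z where "z t = x0 + integral {0..t} (\<lambda>s. f (y (s - h)))" for t
  have "continuous_on UNIV (\<lambda>s. f (y (s - h)))"
    by (intro continuous_intros continuous_on_compose2[OF cont]
        continuous_on_compose2[OF lipschitz_on_continuous_on[OF y(1)]]) auto
  from lipschitz_on_indefinite_integral[OF this bound]
  have "C-lipschitz_on UNIV z"
    by (simp add: z_def lipschitz_on_def)
  moreover have "z 0 = x0" by (simp add: z_def)
  moreover have "z t = x0 + integral {0..t} (\<lambda>s. f (z (s - h)))" if "t \<le> real (Suc k) * h" for t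
  proof -
    have "z (s - h) = y (s - h)" if "s \<in> {0..t}" for s
    proof -
      have "s - h \<le> real k * h" using that \<open>t \<le> real (Suc k) * h\<close> by (auto simp: algebra_simps)
      from eq[OF this] show ?thesis by (simp add: z_def)
    qed
    hence "integral {0..t} (\<lambda>s. f (y (s - h))) = integral {0..t} (\<lambda>s. f (z (s - h)))"
      by (intro integral_cong) simp
    thus ?thesis by (simp add: z_def)
  qed
  ultimately show ?case by blast
qed

text \<open>A version of Arzela-Ascoli on the whole line: a diagonal subsequence converges at the
  rational times, and the common Lipschitz constant carries this over to all times.  Pointwise
  convergence is enough for passing to the limit under an integral.\<close>

lemma lipschitz_sequence_convergent_subsequence:
  fixes x :: "nat \<Rightarrow> real \<Rightarrow> 'a::euclidean_space"
  assumes lip: "\<And>n. C-lipschitz_on UNIV (x n)" and init: "\<And>n. x n 0 = x0"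
  shows "\<exists>k X. strict_mono (k :: nat \<Rightarrow> nat) \<and> (\<forall>t. (\<lambda>n. x (k n) t) \<longlonglongrightarrow> X t) \<and>
    C-lipschitz_on UNIV X"
proof -
  have C: "0 \<le> C" using lip lipschitz_on_nonneg by blast
  \<comment> \<open>The values at time \<open>t\<close> grow linearly in \<open>t\<close>; rescaling makes them uniformly bounded,
    as the selection theorem requires.\<close>
  have bound: "norm (x n t /\<^sub>R (1 + \<bar>t\<bar>)) \<le> norm x0 + C" for n t
  proof -
    have "norm (x n t - x0) \<le> C * \<bar>t\<bar>"
      using lipschitz_on_normD[OF lip, of t 0 n] init by simp
    hence "norm (x n t) \<le> norm x0 + C * \<bar>t\<bar>"
      using norm_triangle_sub[of "x n t" x0] by linarith
    also have "\<dots> \<le> (norm x0 + C) * (1 + \<bar>t\<bar>)"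
      using C by (simp add: algebra_simps)
    finally show ?thesis by (simp add: divide_simps)
  qed
  obtain k where k: "strict_mono (k :: nat \<Rightarrow> nat)"
    and conv: "\<And>q. q \<in> \<rat> \<Longrightarrow> \<exists>l. (\<lambda>n. x (k n) q /\<^sub>R (1 + \<bar>q\<bar>)) \<longlonglongrightarrow> l"
    using function_convergent_subsequence[of "\<rat>" "\<lambda>n t. x n t /\<^sub>R (1 + \<bar>t\<bar>)" "norm x0 + C"]
      bound countable_rat by blast
  have Cauchy_rat: "Cauchy (\<lambda>n. x (k n) q)" if q: "q \<in> \<rat>" for q
  proof -
    obtain l where "(\<lambda>n. x (k n) q /\<^sub>R (1 + \<bar>q\<bar>)) \<longlonglongrightarrow> l" using conv[OF q] by blast
    from tendsto_scaleR[OF tendsto_const[of "1 + \<bar>q\<bar>"] this]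
    moreover have "1 + \<bar>q\<bar> \<noteq> 0" by linarith
    ultimately have "(\<lambda>n. x (k n) q) \<longlonglongrightarrow> (1 + \<bar>q\<bar>) *\<^sub>R l" by simp
    thus ?thesis by (rule LIMSEQ_imp_Cauchy)
  qed
  have "Cauchy (\<lambda>n. x (k n) t)" for t
  proof (rule CauchyI)
    fix e :: real assume "0 < e"
    have "0 < e / (3 * (C + 1))" using C \<open>0 < e\<close> by simp
    then obtain q where q: "q \<in> \<rat>" "t < q" "q < t + e / (3 * (C + 1))"
      using Rats_dense_in_real[of t "t + e / (3 * (C + 1))"] by auto
    have "C * \<bar>t - q\<bar> \<le> (C + 1) * \<bar>t - q\<bar>" by (simp add: mult_right_mono)
    also have "\<dots> < (C + 1) * (e / (3 * (C + 1)))"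
      using q C by (intro mult_strict_left_mono) auto
    also have "\<dots> = e / 3" using C by (simp add: field_simps)
    finally have close: "norm (x n t - x n q) < e / 3" for n
      using lipschitz_on_normD[OF lip, of t q n] by simp
    obtain M where M: "\<And>m n. m \<ge> M \<Longrightarrow> n \<ge> M \<Longrightarrow> norm (x (k m) q - x (k n) q) < e / 3"
      using CauchyD[OF Cauchy_rat[OF q(1)], of "e / 3"] \<open>0 < e\<close> by auto
    have "norm (x (k m) t - x (k n) t) < e" if "m \<ge> M" "n \<ge> M" for m n
    proof -
      have "x (k m) t - x (k n) t
          = (x (k m) t - x (k m) q) + (x (k m) q - x (k n) q) + (x (k n) q - x (k n) t)"
        by simp
      also have "norm \<dots> \<le> norm (x (k m) t - x (k m) q) + norm (x (k m) q - x (k n) q)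
          + norm (x (k n) q - x (k n) t)"
        by (intro norm_triangle_mono order_refl)
      finally show ?thesis
        using close[of "k m"] close[of "k n"] M[OF that] by (simp add: norm_minus_commute)
    qed
    thus "\<exists>M. \<forall>m\<ge>M. \<forall>n\<ge>M. norm (x (k m) t - x (k n) t) < e" by blast
  qed
  hence "\<exists>X. \<forall>t. (\<lambda>n. x (k n) t) \<longlonglongrightarrow> X t"
    by (intro choice allI) (simp add: Cauchy_convergent_iff convergent_def)
  then obtain X where X: "\<And>t. (\<lambda>n. x (k n) t) \<longlonglongrightarrow> X t" by blast
  have "C-lipschitz_on UNIV X"
  proof (rule lipschitz_onI)
    fix s t
    have "(\<lambda>n. dist (x (k n) s) (x (k n) t)) \<longlonglongrightarrow> dist (X s) (X t)"
      by (intro tendsto_dist X)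
    thus "dist (X s) (X t) \<le> C * dist s t"
      by (rule LIMSEQ_le_const2) (use lipschitz_onD[OF lip] in auto)
  qed (rule C)
  with k X show ?thesis by blast
qed

text \<open>Boundedness of the field gives all Tonelli approximations the same Lipschitz constant, so
  a subsequence converges.  As the delay tends to \<open>0\<close>, dominated convergence turns their
  delayed integral equations into the integral equation of the flow.\<close>

theorem peano_global:
  fixes f :: "'a::euclidean_space \<Rightarrow> 'a"
  assumes cont: "continuous_on UNIV f" and bound: "\<And>x. norm (f x) \<le> C"
  obtains X where "X 0 = x0"
    "\<And>t. 0 \<le> t \<Longrightarrow> (X has_vector_derivative f (X t)) (at t within {0..})"
proof -
  \<comment> \<open>Delay \<open>1 / (n + 1)\<close>, with enough steps for the \<open>n\<close>-th approximation to satisfy its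
    equation up to time \<open>n\<close>.\<close>
  define h where "h n = inverse (real (Suc n))" for n
  have h: "0 < h n" for n by (simp add: h_def)
  have "\<exists>x. \<forall>n. C-lipschitz_on UNIV (x n) \<and> x n 0 = x0 \<and>
    (\<forall>t \<le> real (n * Suc n) * h n. x n t = x0 + integral {0..t} (\<lambda>s. f (x n (s - h n))))"
    by (intro choice allI delayed_solution[OF cont bound h])
  then obtain x where lip: "\<And>n. C-lipschitz_on UNIV (x n)" and init: "\<And>n. x n 0 = x0"
    and eq: "\<And>n t. t \<le> real (n * Suc n) * h n \<Longrightarrow>
      x n t = x0 + integral {0..t} (\<lambda>s. f (x n (s - h n)))"
    by blast
  obtain k X where k: "strict_mono (k :: nat \<Rightarrow> nat)"
    and X': "\<forall>t. (\<lambda>n. x (k n) t) \<longlonglongrightarrow> X t" and lipX: "C-lipschitz_on UNIV X"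
    using lipschitz_sequence_convergent_subsequence[where x = x, OF lip init] by metis
  note X = X'[rule_format]
  have contX: "continuous_on UNIV X" by (rule lipschitz_on_continuous_on[OF lipX])
  have contfX: "continuous_on S (\<lambda>s. f (X s))" for S
    using continuous_on_compose2[OF cont contX] continuous_on_subset by blast
  have h0: "(\<lambda>n. h (k n)) \<longlonglongrightarrow> 0"
    using LIMSEQ_subseq_LIMSEQ[OF LIMSEQ_inverse_real_of_nat k] by (simp add: h_def o_def)
  have delayed: "(\<lambda>n. x (k n) (s - h (k n))) \<longlonglongrightarrow> X s" for s
  proof -
    have "(\<lambda>n. x (k n) (s - h (k n)) - x (k n) s) \<longlonglongrightarrow> 0"
    proof (rule Lim_null_comparison)
      show "\<forall>\<^sub>F n in sequentially. norm (x (k n) (s - h (k n)) - x (k n) s) \<le> C * h (k n)"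
        using lipschitz_on_normD[OF lip, of "s - h (k n)" s "k n" for n] h
        by (intro always_eventually allI) (simp add: less_imp_le)
      show "(\<lambda>n. C * h (k n)) \<longlonglongrightarrow> 0" using tendsto_mult_right_zero[OF h0] .
    qed
    from tendsto_add[OF this X[of s]] show ?thesis by simp
  qed
  have integral_eq: "X t = x0 + integral {0..t} (\<lambda>s. f (X s))" for t
  proof -
    have "(\<lambda>n. integral {0..t} (\<lambda>s. f (x (k n) (s - h (k n))))) \<longlonglongrightarrow> integral {0..t} (\<lambda>s. f (X s))"
    proof (rule dominated_convergence(2)[where h = "\<lambda>_. C"])
      show "(\<lambda>s. f (x (k n) (s - h (k n)))) integrable_on {0..t}" for n
        by (intro integrable_continuous_real continuous_on_compose2[OF cont]
            continuous_on_compose2[OF lipschitz_on_continuous_on[OF lip]] continuous_intros) auto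
      show "(\<lambda>n. f (x (k n) (s - h (k n)))) \<longlonglongrightarrow> f (X s)" for s
        by (rule continuous_on_tendsto_compose[OF cont delayed]) auto
    qed (auto intro: bound)
    hence "(\<lambda>n. x0 + integral {0..t} (\<lambda>s. f (x (k n) (s - h (k n)))))
        \<longlonglongrightarrow> x0 + integral {0..t} (\<lambda>s. f (X s))"
      by (intro tendsto_intros)
    moreover have "\<forall>\<^sub>F n in sequentially.
        x0 + integral {0..t} (\<lambda>s. f (x (k n) (s - h (k n)))) = x (k n) t"
      using eventually_ge_at_top[of "nat \<lceil>t\<rceil>"]
    proof eventually_elim
      case (elim n)
      have "t \<le> real (k n)"
        using elim seq_suble[OF k, of n] by linarith
      moreover have "real (k n * Suc (k n)) * h (k n) = real (k n)"
        unfolding h_def of_nat_mult mult.assoc by (subst right_inverse) simp_all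
      ultimately show ?case using eq[of t "k n"] by simp
    qed
    ultimately have "(\<lambda>n. x (k n) t) \<longlonglongrightarrow> x0 + integral {0..t} (\<lambda>s. f (X s))"
      by (rule Lim_transform_eventually)
    thus ?thesis using X LIMSEQ_unique by blast
  qed
  show thesis
  proof (rule that)
    show "X 0 = x0" using integral_eq[of 0] by simp
    fix t :: real assume t: "0 \<le> t"
    have "((\<lambda>u. x0 + integral {0..u} (\<lambda>s. f (X s))) has_vector_derivative 0 + f (X t))
        (at t within {0..t + 1})"
      by (intro has_vector_derivative_add has_vector_derivative_const
          integral_has_vector_derivative contfX) (use t in auto)
    hence "(X has_vector_derivative f (X t)) (at t within {0..t + 1})"
      by (simp add: integral_eq[symmetric])
    moreover have "at t within {0..t + 1} = at t within {0..}"
      by (rule at_within_nhd[where S = "{..<t + 1}"]) auto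
    ultimately show "(X has_vector_derivative f (X t)) (at t within {0..})" by simp
  qed
qed


section \<open>Uniqueness for locally Lipschitz fields\<close>

text \<open>A pointwise notion, stable under sums, products and compositions, so that local Lipschitz
  continuity of the curvature can be read off from its formula.\<close>

definition lipschitz_near :: "('a::metric_space \<Rightarrow> 'b::metric_space) \<Rightarrow> 'a \<Rightarrow> bool" where
  "lipschitz_near f p \<longleftrightarrow> (\<exists>L U. open U \<and> p \<in> U \<and> L-lipschitz_on U f)"

lemma lipschitz_nearI: "open U \<Longrightarrow> p \<in> U \<Longrightarrow> L-lipschitz_on U f \<Longrightarrow> lipschitz_near f p"
  unfolding lipschitz_near_def by blast

lemma lipschitz_near_const: "lipschitz_near (\<lambda>x. c) p"
  by (rule lipschitz_nearI[OF open_UNIV UNIV_I lipschitz_on_constant])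

lemma lipschitz_near_vec_nth: "lipschitz_near (\<lambda>x. x $ i) p"
  by (rule lipschitz_nearI[of UNIV _ 1]) (auto intro!: lipschitz_onI dist_vec_nth_le)

lemma lipschitz_near_add:
  fixes f g :: "'a::metric_space \<Rightarrow> 'b::real_normed_vector"
  assumes "lipschitz_near f p" "lipschitz_near g p"
  shows "lipschitz_near (\<lambda>x. f x + g x) p"
proof -
  obtain L U M V where "open U" "p \<in> U" "L-lipschitz_on U f" "open V" "p \<in> V" "M-lipschitz_on V g"
    using assms unfolding lipschitz_near_def by blast
  thus ?thesis
    by (intro lipschitz_nearI[of "U \<inter> V" p "L + M"] lipschitz_on_add)
       (auto intro: lipschitz_on_subset)
qed

lemma lipschitz_near_sum:
  fixes f :: "'i \<Rightarrow> 'a::metric_space \<Rightarrow> 'b::real_normed_vector"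
  assumes "\<And>i. i \<in> A \<Longrightarrow> lipschitz_near (f i) p"
  shows "lipschitz_near (\<lambda>x. \<Sum>i\<in>A. f i x) p"
  using assms
  by (induction A rule: infinite_finite_induct) (simp_all add: lipschitz_near_const lipschitz_near_add)

lemma lipschitz_near_compose:
  assumes "lipschitz_near f p" "lipschitz_near g (f p)"
  shows "lipschitz_near (\<lambda>x. g (f x)) p"
proof -
  obtain L U M V where U: "open U" "p \<in> U" "L-lipschitz_on U f"
    and V: "open V" "f p \<in> V" "M-lipschitz_on V g"
    using assms unfolding lipschitz_near_def by blast
  have "open (f -` V \<inter> U)"
    using lipschitz_on_continuous_on[OF U(3)] U(1) V(1) by (simp add: continuous_on_open_vimage)
  moreover have "(M * L)-lipschitz_on (f -` V \<inter> U) (\<lambda>x. g (f x))"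
    by (rule lipschitz_on_compose2[OF lipschitz_on_subset[OF U(3)] lipschitz_on_subset[OF V(3)]]) auto
  ultimately show ?thesis
    using U(2) V(2) by (intro lipschitz_nearI) auto
qed

lemma lipschitz_near_mult:
  fixes f g :: "'a::metric_space \<Rightarrow> real"
  assumes "lipschitz_near f p" "lipschitz_near g p"
  shows "lipschitz_near (\<lambda>x. f x * g x) p"
proof -
  obtain L U M V where U: "open U" "p \<in> U" "L-lipschitz_on U f"
    and V: "open V" "p \<in> V" "M-lipschitz_on V g"
    using assms unfolding lipschitz_near_def by blast
  define A where "A = \<bar>f p\<bar> + L"
  define B where "B = \<bar>g p\<bar> + M"
  define W where "W = U \<inter> V \<inter> ball p 1"
  have LM: "0 \<le> L" "0 \<le> M" using U(3) V(3) lipschitz_on_nonneg by blast+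
  have A: "\<bar>f x\<bar> \<le> A" if "x \<in> W" for x
  proof -
    have "dist (f x) (f p) \<le> L * dist x p"
      using that U by (intro lipschitz_onD[OF U(3)]) (auto simp: W_def)
    also have "\<dots> \<le> L * 1" using that LM by (intro mult_left_mono) (auto simp: W_def dist_commute)
    finally show ?thesis by (simp add: A_def dist_real_def)
  qed
  have B: "\<bar>g x\<bar> \<le> B" if "x \<in> W" for x
  proof -
    have "dist (g x) (g p) \<le> M * dist x p"
      using that V by (intro lipschitz_onD[OF V(3)]) (auto simp: W_def)
    also have "\<dots> \<le> M * 1" using that LM by (intro mult_left_mono) (auto simp: W_def dist_commute)
    finally show ?thesis by (simp add: B_def dist_real_def)
  qed
  have "(A * M + B * L)-lipschitz_on W (\<lambda>x. f x * g x)"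
  proof (rule lipschitz_onI)
    fix x y assume xy: "x \<in> W" "y \<in> W"
    have "\<bar>f x * g x - f y * g y\<bar> = \<bar>f x * (g x - g y) + g y * (f x - f y)\<bar>"
      by (simp add: algebra_simps)
    also have "\<dots> \<le> \<bar>f x\<bar> * \<bar>g x - g y\<bar> + \<bar>g y\<bar> * \<bar>f x - f y\<bar>"
      by (simp only: abs_mult[symmetric] abs_triangle_ineq)
    also have "\<dots> \<le> A * (M * dist x y) + B * (L * dist x y)"
    proof (intro add_mono mult_mono)
      show "\<bar>g x - g y\<bar> \<le> M * dist x y"
        using lipschitz_onD[OF V(3), of x y] xy by (auto simp: W_def dist_real_def)
      show "\<bar>f x - f y\<bar> \<le> L * dist x y"
        using lipschitz_onD[OF U(3), of x y] xy by (auto simp: W_def dist_real_def)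
    qed (use A B xy LM in \<open>auto simp: A_def B_def\<close>)
    finally show "dist (f x * g x) (f y * g y) \<le> (A * M + B * L) * dist x y"
      by (simp add: dist_real_def algebra_simps)
  qed (use LM in \<open>auto simp: A_def B_def\<close>)
  thus ?thesis
    using U V by (intro lipschitz_nearI[of W]) (auto simp: W_def)
qed

lemma lipschitz_near_diff:
  fixes f g :: "'a::metric_space \<Rightarrow> real"
  assumes "lipschitz_near f p" "lipschitz_near g p"
  shows "lipschitz_near (\<lambda>x. f x - g x) p"
  using lipschitz_near_add[OF assms(1) lipschitz_near_mult[OF lipschitz_near_const[of "-1"] assms(2)]]
  by simp

lemma lipschitz_near_cong:
  assumes "lipschitz_near g p" "open V" "p \<in> V" "\<And>x. x \<in> V \<Longrightarrow> f x = g x"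
  shows "lipschitz_near f p"
proof -
  obtain L U where U: "open U" "p \<in> U" "L-lipschitz_on U g"
    using assms(1) unfolding lipschitz_near_def by blast
  have "L-lipschitz_on (U \<inter> V) g" by (rule lipschitz_on_subset[OF U(3)]) auto
  hence "L-lipschitz_on (U \<inter> V) f" using assms(4) by (simp add: lipschitz_on_def)
  thus ?thesis using U assms by (intro lipschitz_nearI[of "U \<inter> V"]) auto
qed

lemma lipschitz_near_vec_lambda:
  fixes f :: "'a::metric_space \<Rightarrow> real^'n::finite"
  assumes "\<And>i. lipschitz_near (\<lambda>x. f x $ i) p"
  shows "lipschitz_near f p"
proof -
  have "\<exists>L U. \<forall>i. open (U i) \<and> p \<in> U i \<and> (L i)-lipschitz_on (U i) (\<lambda>x. f x $ i)"
    using assms unfolding lipschitz_near_def by metis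
  then obtain L U where *: "\<And>i. open (U i)" "\<And>i. p \<in> U i"
    "\<And>i. (L i)-lipschitz_on (U i) (\<lambda>x. f x $ i)" by blast
  have "(\<Sum>i\<in>UNIV. L i)-lipschitz_on (\<Inter>i. U i) f"
  proof (rule lipschitz_onI)
    fix x y assume xy: "x \<in> (\<Inter>i. U i)" "y \<in> (\<Inter>i. U i)"
    have "dist (f x) (f y) \<le> (\<Sum>i\<in>UNIV. \<bar>(f x - f y) $ i\<bar>)"
      unfolding dist_norm by (rule norm_le_l1_cart)
    also have "\<dots> \<le> (\<Sum>i\<in>UNIV. L i * dist x y)"
      using lipschitz_onD[OF *(3)] xy by (intro sum_mono) (auto simp: dist_real_def)
    finally show "dist (f x) (f y) \<le> (\<Sum>i\<in>UNIV. L i) * dist x y"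
      by (simp add: sum_distrib_right)
  qed (use *(3) lipschitz_on_nonneg in \<open>auto intro!: sum_nonneg\<close>)
  thus ?thesis using * by (intro lipschitz_nearI[of "\<Inter>i. U i"]) (auto intro: open_INT)
qed

lemma lipschitz_near_C1:
  fixes g g' :: "real \<Rightarrow> real"
  assumes "open S" "a \<in> S" and deriv: "\<And>x. x \<in> S \<Longrightarrow> (g has_real_derivative g' x) (at x)"
    and cont: "isCont g' a"
  shows "lipschitz_near g a"
proof -
  have "\<forall>\<^sub>F x in nhds a. dist (g' x) (g' a) < 1"
    using cont by (intro tendstoD) (simp_all add: isCont_def tendsto_nhds_iff)
  moreover have "\<forall>\<^sub>F x in nhds a. x \<in> S" using assms by (simp add: eventually_nhds_in_open)
  ultimately have "\<forall>\<^sub>F x in nhds a. x \<in> S \<and> dist (g' x) (g' a) < 1" by eventually_elim simp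
  then obtain d where d: "0 < d" "\<And>x. dist x a < d \<Longrightarrow> x \<in> S \<and> dist (g' x) (g' a) < 1"
    unfolding eventually_nhds_metric by blast
  have "(\<bar>g' a\<bar> + 1)-lipschitz_on (ball a d) g"
  proof (rule bounded_derivative_imp_lipschitz)
    fix x assume x: "x \<in> ball a d"
    have "(g has_field_derivative g' x) (at x within ball a d)"
      using d(2)[of x] x deriv by (auto simp: dist_commute intro: has_field_derivative_at_within)
    thus "(g has_derivative (\<lambda>h. g' x * h)) (at x within ball a d)"
      by (simp add: has_field_derivative_def)
    have "\<bar>g' x\<bar> \<le> \<bar>g' a\<bar> + 1" using d(2)[of x] x by (auto simp: dist_commute dist_real_def)
    thus "onorm (\<lambda>h. g' x * h) \<le> \<bar>g' a\<bar> + 1"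
      by (intro onorm_le) (simp add: abs_mult mult_right_mono)
  qed auto
  thus ?thesis using d(1) by (intro lipschitz_nearI[of "ball a d"]) auto
qed

lemma lipschitz_near_cosh: "lipschitz_near cosh (x :: real)"
  by (rule lipschitz_near_C1[of UNIV _ _ sinh]) (auto intro!: derivative_eq_intros continuous_intros)

lemma lipschitz_near_sinh: "lipschitz_near sinh (x :: real)"
  by (rule lipschitz_near_C1[of UNIV _ _ cosh]) (auto intro!: derivative_eq_intros continuous_intros)

text \<open>A Gronwall argument: as long as both solutions stay in a neighbourhood where \<open>f\<close> is
  \<open>L\<close>-Lipschitz, \<open>exp (-2 L t) \<bar>x - y\<bar>\<^sup>2\<close> cannot increase.\<close>

lemma initial_agreement_extends:
  fixes f :: "'a::real_inner \<Rightarrow> 'a"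
  assumes dx: "\<And>t. t \<in> {0..b} \<Longrightarrow> (x has_vector_derivative f (x t)) (at t within {0..b})"
    and dy: "\<And>t. t \<in> {0..b} \<Longrightarrow> (y has_vector_derivative f (y t)) (at t within {0..b})"
    and a: "0 \<le> a" "a < b" "x a = y a" and lip: "lipschitz_near f (x a)"
  shows "\<exists>d>0. \<forall>t\<in>{a..a + d}. t \<le> b \<longrightarrow> x t = y t"
proof -
  obtain L U where U: "open U" "x a \<in> U" "L-lipschitz_on U f"
    using lip unfolding lipschitz_near_def by blast
  have cx: "continuous_on {0..b} x" and cy: "continuous_on {0..b} y"
    by (rule continuous_on_vector_derivative[OF dx], assumption) (rule continuous_on_vector_derivative[OF dy])
  have "\<forall>\<^sub>F t in at a within {0..b}. x t \<in> U" "\<forall>\<^sub>F t in at a within {0..b}. y t \<in> U"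
    using cx cy a U by (auto simp: continuous_on_def intro!: topological_tendstoD)
  hence "\<forall>\<^sub>F t in at a within {0..b}. x t \<in> U \<and> y t \<in> U" by eventually_elim simp
  then obtain e where e: "0 < e" "\<And>t. t \<in> {0..b} \<Longrightarrow> t \<noteq> a \<Longrightarrow> dist t a < e \<Longrightarrow> x t \<in> U \<and> y t \<in> U"
    unfolding eventually_at by blast
  define g where "g t = exp (- (2 * L) * t) * ((x t - y t) \<bullet> (x t - y t))" for t
  have "x t = y t" if t: "t \<in> {a..a + e / 2}" "t \<le> b" for t
  proof -
    have "g a \<ge> g t"
    proof (rule DERIV_nonpos_imp_decreasing_open[where f = g and a = a and b = t])
      show "a \<le> t" using t by simp
      show "continuous_on {a..t} g"
        unfolding g_def using a t
        by (intro continuous_intros continuous_on_subset[OF cx] continuous_on_subset[OF cy]) auto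
      fix s assume s: "a < s" "s < t"
      have "at s within {0..b} = at s"
        using s a t by (intro at_within_interior) auto
      hence ds: "(x has_vector_derivative f (x s)) (at s)" "(y has_vector_derivative f (y s)) (at s)"
        using dx[of s] dy[of s] s a t by auto
      have xyU: "x s \<in> U" "y s \<in> U" using e(2)[of s] e(1) s a t by (auto simp: dist_real_def)
      let ?w = "x s - y s" and ?v = "f (x s) - f (y s)"
      have dw: "((\<lambda>t. x t - y t) has_vector_derivative ?v) (at s)"
        using ds by (intro derivative_intros)
      have eq: "(\<lambda>h. ?w \<bullet> (h *\<^sub>R ?v) + (h *\<^sub>R ?v) \<bullet> ?w) = (*) (2 * (?w \<bullet> ?v))"
        by (rule ext) (simp add: inner_commute[of ?v ?w])
      have "((\<lambda>t. (x t - y t) \<bullet> (x t - y t)) has_derivative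
          (\<lambda>h. ?w \<bullet> (h *\<^sub>R ?v) + (h *\<^sub>R ?v) \<bullet> ?w)) (at s)"
        using dw by (intro has_derivative_inner) (simp_all add: has_vector_derivative_def)
      hence "((\<lambda>t. (x t - y t) \<bullet> (x t - y t)) has_real_derivative 2 * (?w \<bullet> ?v)) (at s)"
        unfolding has_field_derivative_def eq .
      hence "(g has_real_derivative
          exp (- (2 * L) * s) * (2 * (?w \<bullet> ?v)) + (exp (- (2 * L) * s) * (- (2 * L))) * (?w \<bullet> ?w)) (at s)"
        unfolding g_def by (auto intro!: derivative_eq_intros)
      moreover have "?w \<bullet> ?v \<le> L * (?w \<bullet> ?w)"
      proof -
        have "?w \<bullet> ?v \<le> norm ?w * norm ?v" by (rule norm_cauchy_schwarz)
        also have "\<dots> \<le> norm ?w * (L * norm ?w)"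
          using lipschitz_on_normD[OF U(3) xyU] by (intro mult_left_mono) auto
        finally show ?thesis by (simp add: dot_square_norm power2_eq_square mult_ac)
      qed
      hence "2 * exp (- (2 * L) * s) * (?w \<bullet> ?v - L * (?w \<bullet> ?w)) \<le> 0"
        by (intro mult_nonneg_nonpos) auto
      hence "exp (- (2 * L) * s) * (2 * (?w \<bullet> ?v)) + (exp (- (2 * L) * s) * (- (2 * L))) * (?w \<bullet> ?w) \<le> 0"
        by (simp only: right_diff_distrib)
      ultimately show "\<exists>z. (g has_real_derivative z) (at s) \<and> z \<le> 0" by blast
    qed
    moreover have "g a = 0" using a by (simp add: g_def)
    ultimately have "(x t - y t) \<bullet> (x t - y t) \<le> 0"
      by (simp add: g_def mult_le_0_iff)
    thus ?thesis by (metis inner_ge_zero inner_eq_zero_iff order_antisym right_minus_eq)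
  qed
  thus ?thesis using e(1) by (intro exI[of _ "e / 2"]) auto
qed

text \<open>Only the points on the first solution have to be points of local Lipschitz continuity: at
  the infimum of the times of disagreement both solutions are at such a point, and they agree a
  little longer.\<close>

theorem solution_unique:
  fixes f :: "'a::real_inner \<Rightarrow> 'a"
  assumes dx: "\<And>t. t \<in> {0..b} \<Longrightarrow> (x has_vector_derivative f (x t)) (at t within {0..b})"
    and dy: "\<And>t. t \<in> {0..b} \<Longrightarrow> (y has_vector_derivative f (y t)) (at t within {0..b})"
    and init: "x 0 = y 0" and lip: "\<And>t. t \<in> {0..b} \<Longrightarrow> lipschitz_near f (x t)"
    and "0 \<le> b"
  shows "x b = y b"
proof (rule ccontr)
  assume "x b \<noteq> y b"
  define S where "S = {t \<in> {0..b}. x t \<noteq> y t}"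
  define a where "a = Inf S"
  have bS: "b \<in> S" using \<open>x b \<noteq> y b\<close> \<open>0 \<le> b\<close> by (simp add: S_def)
  have bdd: "bdd_below S" by (rule bdd_belowI[of _ 0]) (auto simp: S_def)
  have a0: "0 \<le> a" unfolding a_def using bS by (intro cInf_greatest) (auto simp: S_def)
  have ab: "a \<le> b" unfolding a_def using bS bdd by (rule cInf_lower)
  have before: "x t = y t" if "0 \<le> t" "t < a" for t
  proof (rule ccontr)
    assume "x t \<noteq> y t"
    hence "a \<le> t" unfolding a_def using that ab by (intro cInf_lower bdd) (simp add: S_def)
    thus False using that by simp
  qed
  have xa: "x a = y a"
  proof (cases "a = 0")
    case False
    have cx: "continuous_on {0..b} x" and cy: "continuous_on {0..b} y"
      by (rule continuous_on_vector_derivative[OF dx], assumption) (rule continuous_on_vector_derivative[OF dy])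
    have cl: "closure {0..<a} = {0..a}" using False a0 by simp
    have "x a - y a = 0"
    proof (rule continuous_constant_on_closure[where S = "{0..<a}" and f = "\<lambda>t. x t - y t"])
      show "continuous_on (closure {0..<a}) (\<lambda>t. x t - y t)"
        unfolding cl using ab
        by (intro continuous_intros continuous_on_subset[OF cx] continuous_on_subset[OF cy]) auto
    qed (use before a0 cl in auto)
    thus ?thesis by simp
  qed (use init in simp)
  have "a < b" using xa ab \<open>x b \<noteq> y b\<close> by (cases "a = b") auto
  obtain d where d: "0 < d" "\<And>t. t \<in> {a..a + d} \<Longrightarrow> t \<le> b \<Longrightarrow> x t = y t"
    using initial_agreement_extends[OF dx dy a0 \<open>a < b\<close> xa lip[of a]] a0 ab by auto
  have "a + d \<le> a"
  proof (unfold a_def, rule cInf_greatest)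
    show "S \<noteq> {}" using bS by blast
    fix t assume "t \<in> S"
    hence t: "0 \<le> t" "t \<le> b" "x t \<noteq> y t" by (auto simp: S_def)
    have "a \<le> t" unfolding a_def using \<open>t \<in> S\<close> bdd by (rule cInf_lower)
    show "Inf S + d \<le> t"
      using d(2)[of t] t \<open>a \<le> t\<close> by (force simp: a_def)
  qed
  thus False using d(1) by simp
qed


section \<open>Generalized angles and the law of cosines\<close>

text \<open>Clamping the cosine of the law of cosines to \<open>[-1, 1]\<close> before taking \<open>arccos\<close> produces
  exactly the generalized angles: the cosine is at most \<open>-1\<close> or at least \<open>1\<close> precisely when a
  triangle inequality fails.  This makes the continuity of the generalized angles evident.\<close>

definition clamped_arccos :: "real \<Rightarrow> real" where
  "clamped_arccos z = arccos (max (-1) (min 1 z))"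

text \<open>The law of cosines in terms of the hyperbolic cosines \<open>x\<close>, \<open>y\<close>, \<open>z\<close> of the side lengths,
  which depend on the radii by a simpler formula than the lengths do.\<close>

definition angle_cos :: "real \<Rightarrow> real \<Rightarrow> real \<Rightarrow> real" where
  "angle_cos x y z = (y * z - x) / (sqrt (y\<^sup>2 - 1) * sqrt (z\<^sup>2 - 1))"

lemma angle_cos_cosh:
  assumes "0 < b" "0 < c"
  shows "angle_cos (cosh a) (cosh b) (cosh c) = (cosh b * cosh c - cosh a) / (sinh b * sinh c)"
  using assms by (simp add: angle_cos_def sinh_square_eq[symmetric])

lemma angle_cos_le_minus_one_iff:
  assumes "0 < a" "0 < b" "0 < c"
  shows "angle_cos (cosh a) (cosh b) (cosh c) \<le> -1 \<longleftrightarrow> b + c \<le> a"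
proof -
  have "0 < sinh b * sinh c" using assms by simp
  hence "angle_cos (cosh a) (cosh b) (cosh c) \<le> -1 \<longleftrightarrow> cosh (b + c) \<le> cosh a"
    using assms by (auto simp: angle_cos_cosh divide_le_eq cosh_add)
  thus ?thesis using assms by (simp add: cosh_real_nonneg_le_iff)
qed

lemma angle_cos_ge_one_iff:
  assumes "0 < a" "0 < b" "0 < c"
  shows "1 \<le> angle_cos (cosh a) (cosh b) (cosh c) \<longleftrightarrow> a + c \<le> b \<or> a + b \<le> c"
proof -
  have "0 < sinh b * sinh c" using assms by simp
  hence "1 \<le> angle_cos (cosh a) (cosh b) (cosh c) \<longleftrightarrow> cosh a \<le> cosh \<bar>b - c\<bar>"
    using assms by (auto simp: angle_cos_cosh le_divide_eq cosh_diff)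
  also have "\<dots> \<longleftrightarrow> a \<le> \<bar>b - c\<bar>"
    using assms by (subst cosh_real_nonneg_le_iff) auto
  also have "\<dots> \<longleftrightarrow> a + c \<le> b \<or> a + b \<le> c" by linarith
  finally show ?thesis .
qed

lemma gen_angle_eq_clamped_arccos:
  assumes "0 < a" "0 < b" "0 < c"
  shows "gen_angle a b c = clamped_arccos (angle_cos (cosh a) (cosh b) (cosh c))"
proof -
  note iffs = angle_cos_le_minus_one_iff[OF assms] angle_cos_ge_one_iff[OF assms]
  consider "triangle_ineqs a b c" | "b + c \<le> a" | "a + c \<le> b \<or> a + b \<le> c"
    unfolding triangle_ineqs_def by linarith
  thus ?thesis
  proof cases
    case 1
    hence "-1 < angle_cos (cosh a) (cosh b) (cosh c)" "angle_cos (cosh a) (cosh b) (cosh c) < 1"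
      using iffs by (auto simp: triangle_ineqs_def not_le[symmetric])
    thus ?thesis
      using 1 assms by (simp add: gen_angle_def inner_angle_law_of_cosines clamped_arccos_def angle_cos_cosh)
  next
    case 2
    thus ?thesis using iffs(1) by (simp add: gen_angle_def triangle_ineqs_def clamped_arccos_def)
  next
    case 3
    hence "\<not> b + c \<le> a" "\<not> triangle_ineqs a b c" using assms by (auto simp: triangle_ineqs_def)
    thus ?thesis using 3 iffs(2) by (simp add: gen_angle_def clamped_arccos_def)
  qed
qed

lemma clamped_arccos_bounds: "0 \<le> clamped_arccos z" "clamped_arccos z \<le> pi"
  by (simp_all add: clamped_arccos_def arccos_lbound arccos_ubound)

lemma continuous_on_clamped_arccos: "continuous_on UNIV clamped_arccos"
  unfolding clamped_arccos_def by (intro continuous_intros) auto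

lemma lipschitz_near_clamped_arccos:
  assumes "-1 < z" "z < 1"
  shows "lipschitz_near clamped_arccos z"
proof (rule lipschitz_near_C1[where S = "{-1<..<1}"])
  fix x :: real assume x: "x \<in> {-1<..<1}"
  have "(arccos has_real_derivative inverse (- sqrt (1 - x\<^sup>2))) (at x)"
    using x by (intro DERIV_arccos) auto
  thus "(clamped_arccos has_real_derivative inverse (- sqrt (1 - x\<^sup>2))) (at x)"
    by (rule has_field_derivative_transform_within_open[where S = "{-1<..<1}"])
       (use x in \<open>auto simp: clamped_arccos_def\<close>)
next
  have "z\<^sup>2 < 1" using assms by (simp add: abs_square_less_1)
  thus "isCont (\<lambda>x. inverse (- sqrt (1 - x\<^sup>2))) z" by (intro continuous_intros) auto
qed (use assms in auto)

lemma clamped_arccos_less: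
  assumes "0 < \<epsilon>" "\<epsilon> \<le> pi" "cos \<epsilon> < z"
  shows "clamped_arccos z < \<epsilon>"
proof -
  have "cos \<epsilon> < 1" using assms cos_monotone_0_pi[of 0 \<epsilon>] by simp
  have "clamped_arccos z < arccos (cos \<epsilon>)"
    unfolding clamped_arccos_def using assms \<open>cos \<epsilon> < 1\<close>
    by (intro arccos_less_mono[THEN iffD2]) (auto simp: abs_le_iff min_def max_def)
  thus ?thesis using assms by (simp add: arccos_cos)
qed

definition cosh_edge_length :: "('n::finite set \<Rightarrow> real) \<Rightarrow> real^'n \<Rightarrow> 'n \<Rightarrow> 'n \<Rightarrow> real" where
  "cosh_edge_length I r i j =
     cosh (r $ i) * cosh (r $ j) + I {i, j} * sinh (r $ i) * sinh (r $ j)"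

lemma cosh_edge_length_ge:
  assumes "r \<in> positive_orthant" "0 \<le> I {i, j}"
  shows "cosh (r $ i) * cosh (r $ j) \<le> cosh_edge_length I r i j"
  using assms by (simp add: cosh_edge_length_def positive_orthant_def less_imp_le)

lemma cosh_edge_length_le:
  assumes "r \<in> positive_orthant" "I {i, j} \<le> m" "0 \<le> m"
  shows "cosh_edge_length I r i j \<le> (1 + m) * (cosh (r $ i) * cosh (r $ j))"
proof -
  have pos: "0 \<le> sinh (r $ i)" "0 \<le> sinh (r $ j)"
    using assms by (simp_all add: positive_orthant_def less_imp_le)
  have "I {i, j} * (sinh (r $ i) * sinh (r $ j)) \<le> m * (cosh (r $ i) * cosh (r $ j))"
    using assms pos by (intro mult_mono) (auto simp: sinh_le_cosh_real)
  thus ?thesis by (simp add: cosh_edge_length_def algebra_simps)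
qed

text \<open>This strict inequality keeps edge lengths positive, and \<^const>\<open>angle_cos\<close> away from its
  singularities.\<close>

lemma cosh_edge_length_gt_one:
  assumes "r \<in> positive_orthant" "0 \<le> I {i, j}"
  shows "1 < cosh_edge_length I r i j"
proof -
  have "1 < cosh (r $ i)" using assms cosh_real_nonneg_less_iff[of 0 "r $ i"] by (simp add: positive_orthant_def less_imp_le)
  hence "1 < cosh (r $ i) * cosh (r $ j)"
    using cosh_real_ge_1[of "r $ j"] by (metis less_1_mult mult.right_neutral order_le_less)
  thus ?thesis using cosh_edge_length_ge[of r I i j, OF assms] by simp
qed

lemma
  assumes "r \<in> positive_orthant" "0 \<le> I {i, j}"
  shows cosh_edge_length_eq: "cosh (edge_length I r i j) = cosh_edge_length I r i j"
    and edge_length_pos: "0 < edge_length I r i j"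
proof -
  note gt = cosh_edge_length_gt_one[of r I i j, OF assms]
  thus "cosh (edge_length I r i j) = cosh_edge_length I r i j"
    by (simp add: edge_length_def cosh_edge_length_def cosh_arcosh_real)
  hence "edge_length I r i j \<noteq> 0" using gt by auto
  moreover have "0 \<le> edge_length I r i j"
    using gt by (simp add: edge_length_def cosh_edge_length_def)
  ultimately show "0 < edge_length I r i j" by simp
qed

lemma face_angle_gen_angle:
  assumes "card {i, j, k} = 3" "r \<in> positive_orthant"
    and "0 \<le> I {i, j}" "0 \<le> I {j, k}" "0 \<le> I {i, k}"
  shows "face_angle gen_angle I r i {i, j, k} = clamped_arccos
    (angle_cos (cosh_edge_length I r j k) (cosh_edge_length I r i j) (cosh_edge_length I r i k))"
  using assms
  by (simp add: face_angle_eq[OF _ gen_angle_commute] gen_angle_eq_clamped_arccos edge_length_pos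
      cosh_edge_length_eq)

text \<open>Since \<open>sinh \<le> cosh\<close>, the cosine of the angle is at least \<open>(y z - x) / (y z)\<close>.\<close>

lemma angle_cos_ge:
  assumes "1 < y" "1 < z" "x \<le> \<delta> * (y * z)" "\<delta> \<le> 1"
  shows "1 - \<delta> \<le> angle_cos x y z"
proof -
  have "0 < y\<^sup>2 - 1" "0 < z\<^sup>2 - 1" using assms by (simp_all add: one_less_power)
  hence s: "0 < sqrt (y\<^sup>2 - 1) * sqrt (z\<^sup>2 - 1)" by simp
  have "sqrt (y\<^sup>2 - 1) \<le> y" "sqrt (z\<^sup>2 - 1) \<le> z"
    using assms by (auto intro!: real_le_lsqrt)
  hence "sqrt (y\<^sup>2 - 1) * sqrt (z\<^sup>2 - 1) \<le> y * z"
    using assms \<open>0 < y\<^sup>2 - 1\<close> \<open>0 < z\<^sup>2 - 1\<close> by (intro mult_mono) auto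
  hence "(1 - \<delta>) * (sqrt (y\<^sup>2 - 1) * sqrt (z\<^sup>2 - 1)) \<le> (1 - \<delta>) * (y * z)"
    using assms by (intro mult_left_mono) auto
  also have "\<dots> \<le> y * z - x" using assms by (simp add: algebra_simps)
  finally show ?thesis using s by (simp add: angle_cos_def le_divide_eq)
qed

text \<open>An angle at a vertex of large radius is small, uniformly in the two other radii.  The
  adjacent sides satisfy \<open>cosh l\<^sub>i\<^sub>j \<ge> cosh r\<^sub>i cosh r\<^sub>j\<close>, and the opposite side satisfies
  \<open>cosh l\<^sub>j\<^sub>k \<le> (1 + m) cosh r\<^sub>j cosh r\<^sub>k\<close>; so
  \<open>cosh l\<^sub>j\<^sub>k / (cosh l\<^sub>i\<^sub>j cosh l\<^sub>i\<^sub>k) \<le> (1 + m) / cosh\<^sup>2 r\<^sub>i\<close>, where \<open>r\<^sub>j\<close> and \<open>r\<^sub>k\<close> have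
  cancelled.\<close>

lemma face_angle_small:
  assumes "card {i, j, k} = 3" "r \<in> positive_orthant"
    and "0 \<le> I {i, j}" "0 \<le> I {j, k}" "0 \<le> I {i, k}"
    and "I {j, k} \<le> m" "0 < \<epsilon>" "\<epsilon> \<le> pi / 2"
    and large: "1 + m < (1 - cos \<epsilon>) * cosh (r $ i)"
  shows "face_angle gen_angle I r i {i, j, k} < \<epsilon>"
proof -
  define \<delta> where "\<delta> = (1 + m) / (cosh (r $ i))\<^sup>2"
  have m: "0 \<le> m" using assms by linarith
  have c1: "1 \<le> cosh (r $ i)" by (rule cosh_real_ge_1)
  have cos0: "0 \<le> cos \<epsilon>" using assms by (intro cos_ge_zero) auto
  have "cos \<epsilon> \<le> 1" by simp
  hence "(1 - cos \<epsilon>) * cosh (r $ i) \<le> (1 - cos \<epsilon>) * (cosh (r $ i))\<^sup>2"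
    using c1 by (intro mult_left_mono) (auto simp: power2_eq_square)
  hence \<delta>: "\<delta> < 1 - cos \<epsilon>"
    using large c1 by (simp add: \<delta>_def divide_less_eq)
  have "cosh_edge_length I r j k \<le> (1 + m) * (cosh (r $ j) * cosh (r $ k))"
    using assms m by (intro cosh_edge_length_le) auto
  also have "\<dots> = \<delta> * ((cosh (r $ i) * cosh (r $ j)) * (cosh (r $ i) * cosh (r $ k)))"
    using c1 by (simp add: \<delta>_def power2_eq_square)
  also have "\<dots> \<le> \<delta> * (cosh_edge_length I r i j * cosh_edge_length I r i k)"
    using assms m by (intro mult_left_mono mult_mono cosh_edge_length_ge)
      (auto simp: \<delta>_def intro: order_trans[OF _ cosh_edge_length_ge])
  finally have "1 - \<delta> \<le> angle_cos (cosh_edge_length I r j k) (cosh_edge_length I r i j)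
      (cosh_edge_length I r i k)"
    using assms \<delta> cos0 by (intro angle_cos_ge cosh_edge_length_gt_one) auto
  hence "clamped_arccos (angle_cos (cosh_edge_length I r j k) (cosh_edge_length I r i j)
      (cosh_edge_length I r i k)) < \<epsilon>"
    using assms \<delta> pi_gt_zero by (intro clamped_arccos_less) linarith+
  thus ?thesis using assms by (simp add: face_angle_gen_angle)
qed

lemma continuous_on_cosh_edge_length:
  "continuous_on S (\<lambda>r. cosh_edge_length I r i j)"
  unfolding cosh_edge_length_def by (intro continuous_intros)

lemma lipschitz_near_cosh_edge_length:
  "lipschitz_near (\<lambda>r. cosh_edge_length I r i j) p"
  unfolding cosh_edge_length_def
  by (intro lipschitz_near_add lipschitz_near_mult lipschitz_near_const lipschitz_near_cosh
      lipschitz_near_sinh lipschitz_near_compose[OF lipschitz_near_vec_nth])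

lemma continuous_on_angle_cos:
  fixes f g h :: "'a::topological_space \<Rightarrow> real"
  assumes "continuous_on S f" "continuous_on S g" "continuous_on S h"
    and "\<And>x. x \<in> S \<Longrightarrow> 1 < g x" "\<And>x. x \<in> S \<Longrightarrow> 1 < h x"
  shows "continuous_on S (\<lambda>x. angle_cos (f x) (g x) (h x))"
proof -
  have "0 < (g x)\<^sup>2 - 1" "0 < (h x)\<^sup>2 - 1" if "x \<in> S" for x
    using assms(4,5)[OF that] by (simp_all add: one_less_power)
  thus ?thesis unfolding angle_cos_def by (intro continuous_intros assms) force
qed

lemma lipschitz_near_angle_cos:
  fixes f g h :: "'a::metric_space \<Rightarrow> real"
  assumes "lipschitz_near f p" "lipschitz_near g p" "lipschitz_near h p" "1 < g p" "1 < h p"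
  shows "lipschitz_near (\<lambda>x. angle_cos (f x) (g x) (h x)) p"
proof -
  have root: "lipschitz_near (\<lambda>x. inverse (sqrt (x\<^sup>2 - 1))) a" if "1 < a" for a :: real
  proof (rule lipschitz_near_C1[where S = "{1<..}"])
    have pos: "0 < x\<^sup>2 - 1" if "1 < x" for x :: real using that by (simp add: one_less_power)
    show "((\<lambda>x. inverse (sqrt (x\<^sup>2 - 1))) has_real_derivative
        - (inverse (sqrt (x\<^sup>2 - 1)) * (x * inverse (sqrt (x\<^sup>2 - 1))) * inverse (sqrt (x\<^sup>2 - 1)))) (at x)"
      if x: "x \<in> {1<..}" for x
    proof -
      have "1 < x\<^sup>2" using pos[of x] x by simp
      thus ?thesis by (auto intro!: derivative_eq_intros)
    qed
    show "isCont (\<lambda>x. - (inverse (sqrt (x\<^sup>2 - 1)) * (x * inverse (sqrt (x\<^sup>2 - 1))) * inverse (sqrt (x\<^sup>2 - 1)))) a"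
      using pos[OF that] by (intro continuous_intros) auto
  qed (use that in auto)
  show ?thesis
    unfolding angle_cos_def divide_inverse inverse_mult_distrib
    by (intro lipschitz_near_mult lipschitz_near_diff assms
        lipschitz_near_compose[OF assms(2) root] lipschitz_near_compose[OF assms(3) root])
qed

section \<open>The curvature near an admissible point and at large radii\<close>

definition nonneg_inversive_distance :: "'n::finite set set \<Rightarrow> ('n set \<Rightarrow> real) \<Rightarrow> bool" where
  "nonneg_inversive_distance F I \<longleftrightarrow>
     (\<forall>f\<in>F. card f = 3) \<and> (\<forall>f\<in>F. \<forall>e. e \<subseteq> f \<and> card e = 2 \<longrightarrow> 0 \<le> I e)"

lemma nonneg_inversive_distanceE:
  assumes "nonneg_inversive_distance F I" "f \<in> F" "i \<in> f"
  obtains j k where "f = {i, j, k}" "card {i, j, k} = 3"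
    "0 \<le> I {i, j}" "0 \<le> I {j, k}" "0 \<le> I {i, k}"
proof -
  have "card f = 3" using assms by (simp add: nonneg_inversive_distance_def)
  hence "card (f - {i}) = 2" using assms(3) by simp
  then obtain j k where jk: "f - {i} = {j, k}" "j \<noteq> k" by (auto simp: card_2_iff)
  hence f: "f = {i, j, k}" "i \<noteq> j" "i \<noteq> k" using assms(3) by auto
  have "0 \<le> I e" if "e \<subseteq> f" "card e = 2" for e
    using assms that by (simp add: nonneg_inversive_distance_def)
  thus thesis using that[of j k] f jk(2) \<open>card f = 3\<close> by simp
qed

lemma continuous_on_ext_curvature:
  assumes "nonneg_inversive_distance F I"
  shows "continuous_on positive_orthant (\<lambda>r. ext_curvature F I r i)"
proof -
  have "continuous_on positive_orthant (\<lambda>r. face_angle gen_angle I r i f)" if f: "f \<in> F" "i \<in> f" for f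
  proof -
    obtain j k where jk: "f = {i, j, k}" "card {i, j, k} = 3"
      "0 \<le> I {i, j}" "0 \<le> I {j, k}" "0 \<le> I {i, k}"
      using nonneg_inversive_distanceE[OF assms f] by blast
    have "continuous_on positive_orthant (\<lambda>r. clamped_arccos (angle_cos (cosh_edge_length I r j k)
        (cosh_edge_length I r i j) (cosh_edge_length I r i k)))"
      using jk by (intro continuous_on_compose2[OF continuous_on_clamped_arccos]
          continuous_on_angle_cos continuous_on_cosh_edge_length cosh_edge_length_gt_one) auto
    thus ?thesis
      by (rule continuous_on_eq) (use jk in \<open>simp add: face_angle_gen_angle\<close>)
  qed
  thus ?thesis unfolding ext_curvature_def by (intro continuous_intros) auto
qed

lemma ext_curvature_bound:
  assumes "nonneg_inversive_distance F I" "r \<in> positive_orthant"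
  shows "\<bar>ext_curvature F I r i\<bar> \<le> 2 * pi + real (card F) * pi"
proof -
  let ?A = "{f \<in> F. i \<in> f}"
  have "0 \<le> face_angle gen_angle I r i f \<and> face_angle gen_angle I r i f \<le> pi" if "f \<in> ?A" for f
  proof -
    have "f \<in> F" "i \<in> f" using that by auto
    then obtain j k where "f = {i, j, k}" "card {i, j, k} = 3"
      "0 \<le> I {i, j}" "0 \<le> I {j, k}" "0 \<le> I {i, k}"
      using nonneg_inversive_distanceE[OF assms(1)] by blast
    thus ?thesis using assms(2) by (simp add: face_angle_gen_angle clamped_arccos_bounds)
  qed
  hence "0 \<le> (\<Sum>f\<in>?A. face_angle gen_angle I r i f)"
    "(\<Sum>f\<in>?A. face_angle gen_angle I r i f) \<le> real (card ?A) * pi"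
    by (auto intro!: sum_nonneg sum_bounded_above)
  moreover have "real (card ?A) * pi \<le> real (card F) * pi"
    by (intro mult_right_mono of_nat_mono card_mono) auto
  ultimately show ?thesis unfolding ext_curvature_def using pi_gt_zero by linarith
qed

text \<open>At a vertex of large radius all angles are small, so their sum stays below \<open>2 \<pi>\<close>.  This is
  the a priori bound that keeps the radii from growing.\<close>

lemma eventually_ext_curvature_pos:
  fixes F :: "'n::finite set set"
  assumes "nonneg_inversive_distance F I"
  shows "\<forall>\<^sub>F x in at_top. \<forall>r\<in>positive_orthant. \<forall>i. r $ i = x \<longrightarrow> 0 < ext_curvature F I r i"
proof -
  \<comment> \<open>At most \<open>card F\<close> angles meet at a vertex, so angles below \<open>\<epsilon>\<close> sum to less than \<open>\<pi>\<close>;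
    the summand \<open>2\<close> ensures \<open>\<epsilon> \<le> \<pi> / 2\<close>.\<close>
  define \<epsilon> where "\<epsilon> = pi / (real (card F) + 2)"
  define m where "m = (\<Sum>e\<in>UNIV. \<bar>I e\<bar>)"
  have Im: "I e \<le> m" for e
    unfolding m_def using member_le_sum[of e UNIV "\<lambda>e. \<bar>I e\<bar>"] by simp
  have \<epsilon>: "0 < \<epsilon>" by (simp add: \<epsilon>_def add_nonneg_pos)
  have \<epsilon>2: "\<epsilon> \<le> pi / 2"
    unfolding \<epsilon>_def by (rule divide_left_mono) (simp_all add: add_nonneg_pos)
  have "cos \<epsilon> < 1" using cos_monotone_0_pi[of 0 \<epsilon>] \<epsilon> \<epsilon>2 pi_gt_zero by simp
  have "\<forall>\<^sub>F x in at_top. (1 + m) / (1 - cos \<epsilon>) < cosh (x :: real)"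
    using cosh_real_at_top unfolding filterlim_at_top_dense by blast
  thus ?thesis
  proof eventually_elim
    case (elim x)
    show ?case
    proof (intro ballI allI impI)
      fix r :: "real^'n" and i assume r: "r \<in> positive_orthant" and "r $ i = x"
      hence large: "1 + m < (1 - cos \<epsilon>) * cosh (r $ i)"
        using elim \<open>cos \<epsilon> < 1\<close> by (simp add: divide_less_eq mult.commute)
      let ?A = "{f \<in> F. i \<in> f}"
      have "face_angle gen_angle I r i f \<le> \<epsilon>" if "f \<in> ?A" for f
      proof -
        have "f \<in> F" "i \<in> f" using that by auto
        then obtain j k where jk: "f = {i, j, k}" "card {i, j, k} = 3"
          "0 \<le> I {i, j}" "0 \<le> I {j, k}" "0 \<le> I {i, k}"
          using nonneg_inversive_distanceE[OF assms] by blast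
        show ?thesis
          unfolding jk(1) using face_angle_small[OF jk(2) r jk(3-5) Im \<epsilon> \<epsilon>2 large] by simp
      qed
      hence "(\<Sum>f\<in>?A. face_angle gen_angle I r i f) \<le> real (card ?A) * \<epsilon>"
        by (intro sum_bounded_above) auto
      also have "\<dots> \<le> real (card F) * \<epsilon>"
        using \<epsilon> by (intro mult_right_mono of_nat_mono card_mono) auto
      also have "\<dots> \<le> pi" by (simp add: \<epsilon>_def divide_le_eq)
      finally show "0 < ext_curvature F I r i"
        unfolding ext_curvature_def using pi_gt_zero by linarith
    qed
  qed
qed

lemma open_positive_orthant: "open positive_orthant"
  unfolding positive_orthant_def by (simp add: Collect_all_eq open_INT open_Collect_less continuous_on_component)

lemma open_admissible:
  fixes F :: "'n::finite set set"
  assumes "nonneg_inversive_distance F I"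
  shows "open (admissible F I)"
proof -
  have cont: "continuous_on positive_orthant (\<lambda>r. edge_length I r i j)" if "0 \<le> I {i, j}" for i j
    unfolding edge_length_def
    by (intro continuous_on_compose2[OF continuous_on_arcosh[OF order_refl]] continuous_intros)
       (use cosh_edge_length_gt_one[where I = I and i = i and j = j, OF _ that] in
         \<open>auto simp: cosh_edge_length_def less_imp_le\<close>)
  define \<Omega> where "\<Omega> i j k = {r \<in> positive_orthant. {i, j, k} \<in> F \<longrightarrow>
    triangle_ineqs (edge_length I r i j) (edge_length I r j k) (edge_length I r i k)}" for i j k
  have "open (\<Omega> i j k)" for i j k
  proof (cases "{i, j, k} \<in> F")
    case True
    have "{i, j, k} \<in> F" "i \<in> {i, j, k}" using True by auto
    hence "card {i, j, k} = 3" and sub: "\<And>e. e \<subseteq> {i, j, k} \<Longrightarrow> card e = 2 \<Longrightarrow> 0 \<le> I e"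
      using assms by (auto simp: nonneg_inversive_distance_def)
    hence ne: "i \<noteq> j" "j \<noteq> k" "i \<noteq> k" by (auto simp: card_insert_if split: if_splits)
    have c: "continuous_on positive_orthant (\<lambda>r. edge_length I r i j)"
      "continuous_on positive_orthant (\<lambda>r. edge_length I r j k)"
      "continuous_on positive_orthant (\<lambda>r. edge_length I r i k)"
      using ne by (auto intro!: cont sub)
    have lt: "open {r \<in> positive_orthant. f r < g r}"
      if "continuous_on positive_orthant f" "continuous_on positive_orthant g"
      for f g :: "real^'n \<Rightarrow> real"
    proof -
      have "{r \<in> positive_orthant. f r < g r} = (\<lambda>r. g r - f r) -` {0<..} \<inter> positive_orthant"
        by auto
      also have "open \<dots>"
        using iffD1[OF continuous_on_open_vimage[OF open_positive_orthant] continuous_on_diff[OF that(2,1)]]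
          open_greaterThan by blast
      finally show ?thesis .
    qed
    have "\<Omega> i j k = {r \<in> positive_orthant. edge_length I r i j < edge_length I r j k + edge_length I r i k}
      \<inter> {r \<in> positive_orthant. edge_length I r j k < edge_length I r i j + edge_length I r i k}
      \<inter> {r \<in> positive_orthant. edge_length I r i k < edge_length I r i j + edge_length I r j k}"
      using True by (auto simp: \<Omega>_def triangle_ineqs_def)
    also have "open \<dots>" by (intro open_Int lt c continuous_intros)
    finally show ?thesis .
  qed (simp add: \<Omega>_def open_positive_orthant)
  moreover have "admissible F I = (\<Inter>i. \<Inter>j. \<Inter>k. \<Omega> i j k)"
    by (auto simp: admissible_def \<Omega>_def)
  ultimately show ?thesis by (simp add: open_INT)
qed

lemma curvature_eq_ext_curvature:
  assumes "nonneg_inversive_distance F I" "r \<in> admissible F I"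
  shows "curvature F I r i = ext_curvature F I r i"
proof -
  have "face_angle inner_angle I r i f = face_angle gen_angle I r i f" if f: "f \<in> F" "i \<in> f" for f
  proof -
    obtain j k where jk: "f = {i, j, k}" "card {i, j, k} = 3"
      using nonneg_inversive_distanceE[OF assms(1) f] by blast
    have "triangle_ineqs (edge_length I r i j) (edge_length I r j k) (edge_length I r i k)"
      using assms(2) f jk by (simp add: admissible_def)
    hence "triangle_ineqs (edge_length I r j k) (edge_length I r i j) (edge_length I r i k)"
      by (auto simp: triangle_ineqs_def)
    thus ?thesis
      using jk by (simp add: face_angle_eq[OF _ gen_angle_commute] face_angle_eq[OF _ inner_angle_commute]
          gen_angle_def)
  qed
  thus ?thesis unfolding curvature_def ext_curvature_def by simp
qed

text \<open>At an admissible point the strict triangle inequalities put every cosine into the open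
  interval \<open>(-1, 1)\<close>, where \<open>arccos\<close> is smooth.\<close>

lemma lipschitz_near_ext_curvature:
  assumes "nonneg_inversive_distance F I" "p \<in> admissible F I"
  shows "lipschitz_near (\<lambda>r. ext_curvature F I r i) p"
proof -
  have p: "p \<in> positive_orthant" using assms(2) by (simp add: admissible_def)
  have "lipschitz_near (\<lambda>r. face_angle gen_angle I r i f) p" if f: "f \<in> F" "i \<in> f" for f
  proof -
    obtain j k where jk: "f = {i, j, k}" "card {i, j, k} = 3"
      "0 \<le> I {i, j}" "0 \<le> I {j, k}" "0 \<le> I {i, k}"
      using nonneg_inversive_distanceE[OF assms(1) f] by blast
    let ?z = "\<lambda>r. angle_cos (cosh_edge_length I r j k)
        (cosh_edge_length I r i j) (cosh_edge_length I r i k)"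
    have "triangle_ineqs (edge_length I p i j) (edge_length I p j k) (edge_length I p i k)"
      using assms(2) f jk by (simp add: admissible_def)
    hence "-1 < ?z p" "?z p < 1"
      using angle_cos_le_minus_one_iff[of "edge_length I p j k" "edge_length I p i j" "edge_length I p i k"]
        angle_cos_ge_one_iff[of "edge_length I p j k" "edge_length I p i j" "edge_length I p i k"] p jk
      by (auto simp: triangle_ineqs_def edge_length_pos cosh_edge_length_eq not_le[symmetric])
    hence "lipschitz_near (\<lambda>r. clamped_arccos (?z r)) p"
      using jk p by (intro lipschitz_near_compose[OF _ lipschitz_near_clamped_arccos]
          lipschitz_near_angle_cos lipschitz_near_cosh_edge_length cosh_edge_length_gt_one)
    thus ?thesis
      by (rule lipschitz_near_cong[OF _ open_positive_orthant p])
         (use jk in \<open>simp add: face_angle_gen_angle\<close>)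
  qed
  thus ?thesis
    unfolding ext_curvature_def
    by (intro lipschitz_near_diff lipschitz_near_const lipschitz_near_sum) auto
qed


section \<open>Long-time existence for the extended flow\<close>

text \<open>The new coordinate \<open>u = - ln (tanh (r / 2))\<close> satisfies \<open>u' = - r' / sinh r\<close> and thus turns the
  flow into \<open>u' = K\<close>, with a bounded right-hand side.  This change of variables is an involution
  of the positive half-line: \<open>sinh u sinh r = 1\<close>.\<close>

definition dual_radius :: "real \<Rightarrow> real" where
  "dual_radius x = - ln (tanh (x / 2))"

lemma dual_radius_pos: "0 < x \<Longrightarrow> 0 < dual_radius x"
  by (simp add: dual_radius_def ln_less_zero tanh_real_lt_1)

lemma dual_radius_antimono: "0 < x \<Longrightarrow> x \<le> y \<Longrightarrow> dual_radius y \<le> dual_radius x"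
  by (simp add: dual_radius_def)

lemma sinh_dual_radius:
  assumes "0 < x"
  shows "sinh (dual_radius x) = 1 / sinh x"
proof -
  have pos: "0 < tanh (x / 2)" "0 < sinh (x / 2)" "0 < cosh (x / 2)" using assms by simp_all
  have "sinh (dual_radius x) = (inverse (tanh (x / 2)) - tanh (x / 2)) / 2"
    using pos by (simp add: dual_radius_def sinh_ln_real field_simps)
  also have "\<dots> = ((cosh (x / 2))\<^sup>2 - (sinh (x / 2))\<^sup>2) / (2 * sinh (x / 2) * cosh (x / 2))"
    using pos by (simp add: tanh_def field_simps power2_eq_square)
  also have "\<dots> = 1 / sinh x"
    using sinh_double[of "x / 2"] by (simp add: cosh_square_eq)
  finally show ?thesis .
qed

lemma dual_radius_dual_radius:
  assumes "0 < x"
  shows "dual_radius (dual_radius x) = x"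
proof -
  have "0 < tanh (x / 2)" using assms by simp
  hence exp: "exp (- dual_radius x) = tanh (x / 2)" by (simp add: dual_radius_def)
  have "tanh (dual_radius x / 2) = (1 - tanh (x / 2)) / (1 + tanh (x / 2))"
    by (simp add: tanh_real_altdef[of "dual_radius x / 2"] exp)
  also have "\<dots> = exp (- x)"
  proof -
    have "1 - (1 - y) / (1 + y) = 2 * y / (1 + y)" "1 + (1 - y) / (1 + y) = 2 / (1 + y)"
      if "0 < y" for y :: real using that by (simp_all add: field_simps)
    moreover have "1 + exp (- x) \<noteq> 0" using exp_gt_zero[of "- x"] by linarith
    ultimately show ?thesis by (simp add: tanh_real_altdef[of "x / 2"])
  qed
  finally show ?thesis by (simp add: dual_radius_def[of "dual_radius x"])
qed

lemma has_real_derivative_dual_radius: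
  assumes "0 < x"
  shows "(dual_radius has_real_derivative - 1 / sinh x) (at x)"
proof -
  have pos: "0 < tanh (x / 2)" "0 < sinh (x / 2)" "0 < cosh (x / 2)" using assms by simp_all
  have "(dual_radius has_real_derivative - ((1 - (tanh (x / 2))\<^sup>2) / 2 / tanh (x / 2))) (at x)"
    unfolding dual_radius_def[abs_def] using pos
    by (auto intro!: derivative_eq_intros simp: field_simps)
  also have "(1 - (tanh (x / 2))\<^sup>2) / 2 / tanh (x / 2) = sinh (dual_radius x)"
    using pos by (simp add: dual_radius_def sinh_ln_real field_simps power2_eq_square)
  finally show ?thesis using assms by (simp add: sinh_dual_radius)
qed

lemma continuous_on_dual_radius: "continuous_on {0<..} dual_radius"
  by (rule DERIV_continuous_on[where D = "\<lambda>x. - 1 / sinh x"])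
     (rule has_field_derivative_at_within[OF has_real_derivative_dual_radius], simp)

text \<open>Below the barrier \<open>g\<close> cannot decrease, so it cannot have moved there after its last visit
  to \<open>{\<beta>..}\<close>.\<close>

lemma lower_barrier:
  fixes g g' :: "real \<Rightarrow> real"
  assumes deriv: "\<And>t. 0 \<le> t \<Longrightarrow> (g has_real_derivative g' t) (at t within {0..})"
    and init: "\<beta> \<le> g 0" and push: "\<And>t. 0 \<le> t \<Longrightarrow> g t < \<beta> \<Longrightarrow> 0 \<le> g' t"
    and "0 \<le> t"
  shows "\<beta> \<le> g t"
proof (rule ccontr)
  assume "\<not> \<beta> \<le> g t"
  have cont: "continuous_on {0..} g"
    by (rule DERIV_continuous_on) (use deriv in auto)
  define S where "S = {0..t} \<inter> g -` {\<beta>..}"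
  define a where "a = Sup S"
  have "closed S"
    unfolding S_def
    by (intro continuous_closed_preimage continuous_on_subset[OF cont]) auto
  moreover have "0 \<in> S" using init \<open>0 \<le> t\<close> by (simp add: S_def)
  moreover have bdd: "bdd_above S" by (rule bdd_aboveI[of _ t]) (simp add: S_def)
  ultimately have "a \<in> S" unfolding a_def by (intro closed_contains_Sup) auto
  hence a: "0 \<le> a" "a \<le> t" "\<beta> \<le> g a" by (auto simp: S_def)
  have below: "g s < \<beta>" if "a < s" "s \<le> t" for s
  proof (rule ccontr)
    assume "\<not> g s < \<beta>"
    hence "s \<in> S" using that a by (simp add: S_def)
    hence "s \<le> a" unfolding a_def using bdd by (rule cSup_upper)
    thus False using that by simp
  qed
  have "g a \<le> g t"
  proof (rule DERIV_nonneg_imp_increasing_open[where f = g and a = a and b = t])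
    fix s assume s: "a < s" "s < t"
    have "at s within {0..} = at s" using s a by (intro at_within_interior) auto
    hence "(g has_real_derivative g' s) (at s)" using deriv[of s] s a by simp
    thus "\<exists>y. (g has_real_derivative y) (at s) \<and> 0 \<le> y" using push[of s] below[of s] s a by auto
  qed (use a in \<open>auto intro: continuous_on_subset[OF cont]\<close>)
  thus False using a(3) \<open>\<not> \<beta> \<le> g t\<close> by simp
qed

text \<open>In the dual coordinates the flow is \<open>u' = K\<close>, and the orthant is again the positive orthant.
  A radius tends to \<open>0\<close> only as \<open>u\<^sub>i\<close> tends to infinity, which takes infinite time as \<open>K\<close> is
  bounded.  A radius tends to infinity only as \<open>u\<^sub>i\<close> tends to \<open>0\<close>, which is prevented by the
  sign of \<open>K\<close> at a large radius \<open>B\<close>.  To get a field on the whole space, the coordinates are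
  clamped from below at the value \<open>\<beta>\<close> corresponding to \<open>B\<close>; the sign condition shows that
  the solution never feels the clamping.\<close>

lemma bounded_field_flow_exists:
  fixes K :: "real^'n::finite \<Rightarrow> 'n \<Rightarrow> real"
  assumes cont: "\<And>i. continuous_on positive_orthant (\<lambda>r. K r i)"
    and bound: "\<And>r i. r \<in> positive_orthant \<Longrightarrow> \<bar>K r i\<bar> \<le> C"
    and large: "\<forall>\<^sub>F x in at_top. \<forall>r\<in>positive_orthant. \<forall>i. r $ i = x \<longrightarrow> 0 \<le> K r i"
    and r0: "r0 \<in> positive_orthant"
  shows "\<exists>R. flow_solution K positive_orthant r0 \<infinity> R"
proof -
  have "\<forall>\<^sub>F x in at_top. r0 $ i \<le> x" for i by (rule eventually_ge_at_top)
  hence "\<forall>\<^sub>F x in at_top. \<forall>i. r0 $ i \<le> x" by (rule eventually_all_finite)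
  with large eventually_gt_at_top[of 0]
  have "\<forall>\<^sub>F x in at_top. 0 < x \<and> (\<forall>i. r0 $ i \<le> x) \<and> (\<forall>r\<in>positive_orthant. \<forall>i. r $ i = x \<longrightarrow> 0 \<le> K r i)"
    by eventually_elim blast
  then obtain B where B: "0 < B" "\<And>i. r0 $ i \<le> B"
    and pushB: "\<And>r i. r \<in> positive_orthant \<Longrightarrow> r $ i = B \<Longrightarrow> 0 \<le> K r i"
    unfolding eventually_at_top_linorder by blast
  define \<beta> where "\<beta> = dual_radius B"
  have \<beta>: "0 < \<beta>" using B(1) by (simp add: \<beta>_def dual_radius_pos)
  define \<rho> :: "real^'n \<Rightarrow> real^'n" where "\<rho> u = (\<chi> i. dual_radius (max \<beta> (u $ i)))" for u
  define f :: "real^'n \<Rightarrow> real^'n" where "f u = (\<chi> i. K (\<rho> u) i)" for u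
  have \<rho>pos: "\<rho> u \<in> positive_orthant" for u
    using \<beta> by (simp add: \<rho>_def positive_orthant_def dual_radius_pos less_max_iff_disj)
  have "continuous_on UNIV \<rho>"
    unfolding \<rho>_def using \<beta>
    by (intro continuous_intros continuous_on_compose2[OF continuous_on_dual_radius]) auto
  hence contf: "continuous_on UNIV f"
    unfolding f_def using \<rho>pos by (intro continuous_on_vec_lambda continuous_on_compose2[OF cont]) auto
  have boundf: "norm (f u) \<le> real CARD('n) * C" for u
  proof -
    have "norm (f u) \<le> (\<Sum>i\<in>UNIV. \<bar>f u $ i\<bar>)" by (rule norm_le_l1_cart)
    also have "\<dots> \<le> real CARD('n) * C"
      using bound[OF \<rho>pos] by (intro sum_bounded_above) (simp add: f_def)
    finally show ?thesis .
  qed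
  obtain U where U0: "U 0 = (\<chi> i. dual_radius (r0 $ i))"
    and dU: "\<And>t. 0 \<le> t \<Longrightarrow> (U has_vector_derivative f (U t)) (at t within {0..})"
    using peano_global[OF contf boundf] by metis
  have dUi: "((\<lambda>t. U t $ i) has_real_derivative K (\<rho> (U t)) i) (at t within {0..})" if "0 \<le> t" for t i
    using bounded_linear.has_vector_derivative[OF bounded_linear_vec_nth dU[OF that], of i]
    by (simp add: f_def has_real_derivative_iff_has_vector_derivative)
  have barrier: "\<beta> \<le> U t $ i" if "0 \<le> t" for t i
  proof (rule lower_barrier[OF dUi _ _ that])
    show "\<beta> \<le> U 0 $ i"
      using r0 B by (simp add: U0 \<beta>_def dual_radius_antimono positive_orthant_def)
    fix s assume "U s $ i < \<beta>"
    hence "\<rho> (U s) $ i = B"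
      using B(1) by (simp add: \<rho>_def \<beta>_def dual_radius_dual_radius)
    thus "0 \<le> K (\<rho> (U s)) i" by (intro pushB \<rho>pos)
  qed
  define R where "R t = (\<chi> i. dual_radius (U t $ i))" for t
  have R\<rho>: "\<rho> (U t) = R t" if "0 \<le> t" for t
    using barrier[OF that] by (simp add: \<rho>_def R_def max_def)
  have "((\<lambda>t. R t $ i) has_real_derivative - K (R t) i * sinh (R t $ i)) (at t within {0..})"
    if t: "0 \<le> t" for t i
  proof -
    have pos: "0 < U t $ i" using barrier[OF t, of i] \<beta> by linarith
    have "((\<lambda>t. dual_radius (U t $ i)) has_real_derivative - 1 / sinh (U t $ i) * K (R t) i)
        (at t within {0..})"
      using DERIV_chain2[OF has_real_derivative_dual_radius[OF pos] dUi[OF t]] R\<rho>[OF t] by simp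
    thus ?thesis using pos by (simp add: R_def sinh_dual_radius mult.commute)
  qed
  moreover have "R 0 = r0"
    using r0 by (simp add: R_def U0 vec_eq_iff positive_orthant_def dual_radius_dual_radius)
  moreover have "R t \<in> positive_orthant" if "0 \<le> t" for t using \<rho>pos R\<rho>[OF that] by metis
  moreover have "time_interval \<infinity> = {0..}" by (auto simp: time_interval_def)
  ultimately show ?thesis unfolding flow_solution_def by auto
qed


section \<open>The curvature flow\<close>

lemma has_vector_derivative_componentwise:
  fixes f :: "real \<Rightarrow> real^'n::finite"
  assumes "\<And>i. ((\<lambda>t. f t $ i) has_real_derivative v $ i) (at t within S)"
  shows "(f has_vector_derivative v) (at t within S)"
  unfolding has_vector_derivative_def
proof (subst has_derivative_componentwise_within, rule ballI)
  fix b :: "real^'n" assume "b \<in> Basis"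
  then obtain i where "b = axis i 1" by (auto simp: Basis_vec_def)
  thus "((\<lambda>x. f x \<bullet> b) has_derivative (\<lambda>h. (h *\<^sub>R v) \<bullet> b)) (at t within S)"
    using assms[of i] by (simp add: inner_axis has_field_derivative_def mult_commute_abs)
qed

theorem theorem1p10:
  fixes M :: "'a topology"
    and E F :: "'n::finite set set"
    and I :: "'n set \<Rightarrow> real"
    and r0 :: "real^'n"
  assumes "closed_surface M"
    and "triangulates E F M"
    and "\<forall>e\<in>E. 0 \<le> I e"
    and "r0 \<in> admissible F I"
  shows "\<exists>(T::ereal) r.
      0 < T \<and>
      flow_solution (curvature F I) (admissible F I) r0 T r \<and>
      (\<forall>T' s. 0 < T' \<and> flow_solution (curvature F I) (admissible F I) r0 T' s \<longrightarrow>
         T' \<le> T \<and> (\<forall>t\<in>time_interval T'. s t = r t)) \<and>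
      (T < \<infinity> \<longrightarrow>
         (\<exists>R. flow_solution (ext_curvature F I) positive_orthant r0 \<infinity> R \<and>
              (\<forall>t\<in>time_interval T. R t = r t)))"
proof -
  have inv: "nonneg_inversive_distance F I"
    using assms(2,3) by (auto simp: nonneg_inversive_distance_def triangulates_def)
  have "r0 \<in> positive_orthant" using assms(4) by (simp add: admissible_def)
  moreover have "\<forall>\<^sub>F x in at_top. \<forall>r\<in>positive_orthant. \<forall>i. r $ i = x \<longrightarrow> 0 \<le> ext_curvature F I r i"
    using eventually_ext_curvature_pos[OF inv] by eventually_elim (auto intro: less_imp_le)
  ultimately obtain R where R: "flow_solution (ext_curvature F I) positive_orthant r0 \<infinity> R"
    using bounded_field_flow_exists[where K = "ext_curvature F I", OF continuous_on_ext_curvature[OF inv] ext_curvature_bound[OF inv]]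
    by blast
  have "time_interval \<infinity> = {0..}" by (auto simp: time_interval_def)
  with R have R0: "R 0 = r0" and Rpos: "\<And>t. 0 \<le> t \<Longrightarrow> R t \<in> positive_orthant"
    and dR: "\<And>t i. 0 \<le> t \<Longrightarrow> ((\<lambda>t. R t $ i) has_real_derivative
        - ext_curvature F I (R t) i * sinh (R t $ i)) (at t within {0..})"
    by (auto simp: flow_solution_def)
  define X :: "real^'n \<Rightarrow> real^'n" where "X r = (\<chi> i. - ext_curvature F I r i * sinh (r $ i))" for r
  have lipX: "lipschitz_near X p" if "p \<in> admissible F I" for p
  proof (rule lipschitz_near_vec_lambda)
    fix i
    have "lipschitz_near (\<lambda>r. (0 - ext_curvature F I r i) * sinh (r $ i)) p"
      by (intro lipschitz_near_mult lipschitz_near_diff lipschitz_near_const lipschitz_near_sinh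
          lipschitz_near_ext_curvature[OF inv that] lipschitz_near_compose[OF lipschitz_near_vec_nth])
    thus "lipschitz_near (\<lambda>r. X r $ i) p" by (simp add: X_def)
  qed
  have dRX: "(R has_vector_derivative X (R t)) (at t within {0..})" if "0 \<le> t" for t
    using dR[OF that] by (intro has_vector_derivative_componentwise) (simp add: X_def)
  \<comment> \<open>\<open>T\<close> is the first exit time from the admissible set; it is \<open>\<infinity>\<close> if \<open>A\<close> is empty.\<close>
  define A where "A = {t. 0 \<le> t \<and> R t \<notin> admissible F I}"
  define T :: ereal where "T = (INF t\<in>A. ereal t)"
  have inside: "R t \<in> admissible F I" if "t \<in> time_interval T" for t
  proof (rule ccontr)
    assume "R t \<notin> admissible F I"
    hence "T \<le> ereal t" unfolding T_def using that by (intro INF_lower) (simp add: A_def time_interval_def)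
    thus False using that by (auto simp: time_interval_def not_le[symmetric])
  qed
  have "0 < T"
  proof -
    have "continuous_on {0..} R" by (rule continuous_on_vector_derivative) (use dRX in auto)
    hence "(R \<longlongrightarrow> r0) (at 0 within {0..})" using R0 by (auto simp: continuous_on_def)
    hence "\<forall>\<^sub>F t in at 0 within {0..}. R t \<in> admissible F I"
      using open_admissible[OF inv] assms(4) by (rule topological_tendstoD)
    then obtain d where d: "0 < d" "\<And>t. 0 \<le> t \<Longrightarrow> t \<noteq> 0 \<Longrightarrow> t < d \<Longrightarrow> R t \<in> admissible F I"
      unfolding eventually_at by (auto simp: dist_real_def)
    have "ereal d \<le> T"
      unfolding T_def
    proof (rule INF_greatest)
      fix t assume "t \<in> A"
      thus "ereal d \<le> ereal t"
        using d(2)[of t] R0 assms(4) by (cases "t = 0") (auto simp: A_def not_less[symmetric])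
    qed
    thus ?thesis using d(1) by (metis ereal_less(2) less_le_trans)
  qed
  moreover have "flow_solution (curvature F I) (admissible F I) r0 T R"
    unfolding flow_solution_def
  proof (intro conjI ballI allI)
    fix t i assume t: "t \<in> time_interval T"
    have "((\<lambda>t. R t $ i) has_real_derivative - ext_curvature F I (R t) i * sinh (R t $ i))
        (at t within time_interval T)"
      by (rule has_field_derivative_subset[OF dR]) (use t in \<open>auto simp: time_interval_def\<close>)
    thus "((\<lambda>t. R t $ i) has_real_derivative - curvature F I (R t) i * sinh (R t $ i))
        (at t within time_interval T)"
      by (simp add: curvature_eq_ext_curvature[OF inv inside[OF t]])
  qed (use R0 inside in auto)
  moreover have "T' \<le> T \<and> (\<forall>t\<in>time_interval T'. s t = R t)"
    if s: "flow_solution (curvature F I) (admissible F I) r0 T' s" for T' s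
  proof -
    have agree: "s t = R t" if t: "t \<in> time_interval T'" for t
    proof (rule solution_unique[where f = X])
      have sub: "{0..t} \<subseteq> time_interval T'"
        using t by (auto simp: time_interval_def intro: le_less_trans[of _ "ereal t"])
      fix u assume u: "u \<in> {0..t}"
      hence uT: "u \<in> time_interval T'" using sub by blast
      have adm: "s u \<in> admissible F I" using s uT by (simp add: flow_solution_def)
      show "lipschitz_near X (s u)" by (rule lipX[OF adm])
      show "(s has_vector_derivative X (s u)) (at u within {0..t})"
      proof (rule has_vector_derivative_componentwise)
        fix i
        have "((\<lambda>t. s t $ i) has_real_derivative - curvature F I (s u) i * sinh (s u $ i))
            (at u within time_interval T')"
          using s uT by (simp add: flow_solution_def)
        thus "((\<lambda>t. s t $ i) has_real_derivative X (s u) $ i) (at u within {0..t})"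
          using has_field_derivative_subset[OF _ sub]
          by (simp add: X_def curvature_eq_ext_curvature[OF inv adm])
      qed
      show "(R has_vector_derivative X (R u)) (at u within {0..t})"
        by (rule has_vector_derivative_within_subset[OF dRX]) (use u in auto)
    next
      show "s 0 = R 0" using s R0 by (simp add: flow_solution_def)
      show "0 \<le> t" using t by (simp add: time_interval_def)
    qed
    have "T' \<le> T"
      unfolding T_def
    proof (rule INF_greatest, rule ccontr)
      fix a assume "a \<in> A" "\<not> T' \<le> ereal a"
      hence a: "a \<in> time_interval T'" "R a \<notin> admissible F I" by (auto simp: A_def time_interval_def)
      thus False using agree[OF a(1)] s by (auto simp: flow_solution_def)
    qed
    with agree show ?thesis by blast
  qed
  ultimately show ?thesis using R by blast
qed

end
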